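(* Let $f:\mathbb R^d\to\mathbb R$ be continuous, scaling-invariant with respect to some $x^*\in\mathbb R^d$, and with Lebesgue-negligible level sets. Let $(m_k,\sigma_k)_{k\in\mathbb N}$ be the sequence produced by the step-size adaptive evolution strategy (with nonsmooth step-size update) applied to $f$, and let $z_k=(m_k-x^* )/\sigma_k$. Then $\{z_k\}_{k\in\mathbb N}$ is a time-homogeneous $\varphi$-irreducible aperiodic T-chain on $X=\mathbb R^d$, for which every compact subset of $X$ is small.
   Context: $f$ is scaling-invariant w.r.t. $x^*$ if for all $x,y\in\mathbb R^d$, $\rho>0$: $f(x+x^* )\le f(y+x^* )\iff f(\rho x+x^* )\le f(\rho y+x^* )$. $f$ has Lebesgue-negligible level sets if $\mathrm{Leb}(\{x:f(x)=t\})=0$ for all $t\in\mathbb R$. **Step-size adaptive ES.** Fix integers $\lambda\ge2$, $\mu\in\{1,\dots,\lambda\}$, weights $w_1\ge\dots\ge w_\mu>0$ with $\sum_iw_i=1$, $\mu_{\mathrm{eff}}=\sum_{i=1}^\mu w_i^2$, and $d_\sigma>0$. Given $m_k\in\mathbb R^d$, $\sigma_k>0$: sample $U_{k+1}^1,\dots,U_{k+1}^\lambda\sim\mathcal N(0,I_d)$ i.i.d. and independent of $(m_k,\sigma_k)$ (and of the past); let $s_{k+1}$ be a permutation of $\{1,\dots,\lambda\}$ with $f(m_k+\sigma_kU_{k+1}^{s_{k+1}(1)})\le\dots\le f(m_k+\sigma_kU_{k+1}^{s_{k+1}(\lambda)})$ (ties broken by index order); set $m_{k+1}=m_k+\sigma_k\sum_{i=1}^\mu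 w_iU_{k+1}^{s_{k+1}(i)}$ and $$\sigma_{k+1}=\sigma_k\exp\left(\frac1{d_\sigma}\left(\frac{\sqrt{\mu_{\mathrm{eff}}}\,\|\sum_{i=1}^\mu w_iU_{k+1}^{s_{k+1}(i)}\|}{\mathbb E\|\mathcal N(0,I_d)\|}-1\right)\right).$$ **Markov chain notions** (for a kernel $P$ on $X$ with iterates $P^k$). $P$ is $\varphi$-irreducible if there is a nontrivial measure $\varphi$ on $\mathcal B(X)$ such that $\varphi(A)>0$ implies $\sum_{k\ge1}P^k(x,A)>0$ for all $x\in X$ (such $\varphi$ is called an irreducibility measure). For a probability $b$ on $\mathbb N=\{0,1,\dots\}$, $K_b=\sum_{k\ge0}b(k)P^k$. $P$ is a T-chain if for some $b$ there is a substochastic kernel $T\le K_b$ with $T(\cdot,A)$ lower semicontinuous for every $A\in\mathcal B(X)$ and $T(x,X)>0$ for all $x$. $C\in\mathcal B(X)$ is small if there are $a\in\mathbb N$ and a nontrivial measure $\nu$ with $P^a(x,A)\ge\nu(A)$ for all $x\in C$, $A\in\mathcal B(X)$. For $P$ $\varphi$-irreducible, a $d$-cycle is a family of disjoint Borel sets $(D_i)_{i\in\mathbb Z/d\mathbb Z}$ with $P(x,D_{i+1})=1$ for $x\in D_i$ and $\varphi((\bigcup_iD_i)^c)=0$ for every irreducibility measure $\varphi$; $P$ is aperiodic if the largest $d$ for which a $d$-cycle exists is $1$. *)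

theory Defs
  imports "HOL-Probability.Probability" "HOL-Combinatorics.Permutations"
begin

section \<open>Objective functions\<close>

definition scaling_invariant :: "('a::real_vector \<Rightarrow> real) \<Rightarrow> 'a \<Rightarrow> bool" where
  "scaling_invariant f xs \<longleftrightarrow>
     (\<forall>x y. \<forall>\<rho>>0. f (x + xs) \<le> f (y + xs) \<longleftrightarrow> f (\<rho> *\<^sub>R x + xs) \<le> f (\<rho> *\<^sub>R y + xs))"

definition negligible_level_sets :: "('a::euclidean_space \<Rightarrow> real) \<Rightarrow> bool" where
  "negligible_level_sets f \<longleftrightarrow> (\<forall>t. {x. f x = t} \<in> null_sets lebesgue)"

section \<open>The step-size adaptive evolution strategy\<close>

definition std_normal_vec :: "(real ^ 'd) measure" where
  "std_normal_vec = density lborel (\<lambda>x. ennreal (\<Prod>i\<in>UNIV. std_normal_density (x $ i)))"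

definition ranks :: "(nat \<Rightarrow> real) \<Rightarrow> nat \<Rightarrow> (nat \<Rightarrow> nat) \<Rightarrow> bool" where
  "ranks g lam s \<longleftrightarrow> s permutes {1..lam} \<and>
     (\<forall>i j. 1 \<le> i \<and> i < j \<and> j \<le> lam \<longrightarrow>
        g (s i) < g (s j) \<or> (g (s i) = g (s j) \<and> s i < s j))"

text \<open>Exactly one permutation orders the values increasingly with ties broken by index
  (\<open>ranks_ex1\<close> below), so the definite description denotes it.\<close>

definition ranking :: "(nat \<Rightarrow> real) \<Rightarrow> nat \<Rightarrow> nat \<Rightarrow> nat" where
  "ranking g lam = (THE s. ranks g lam s)"

lemma sorted_wrt_insort_key_ties:
  fixes g :: "nat \<Rightarrow> real"
  defines "R \<equiv> \<lambda>a b. g a < g b \<or> (g a = g b \<and> a < b)"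
  assumes "sorted_wrt R l" "\<forall>y\<in>set l. x < y"
  shows "sorted_wrt R (insort_key g x l)"
  using assms(2,3)
proof (induction l)
  case Nil
  then show ?case by simp
next
  case (Cons y l)
  then show ?case unfolding R_def by (fastforce simp: set_insort_key)
qed

lemma sorted_wrt_sort_key_ties:
  fixes g :: "nat \<Rightarrow> real"
  assumes "sorted_wrt (<) l"
  shows "sorted_wrt (\<lambda>a b. g a < g b \<or> (g a = g b \<and> a < b)) (sort_key g l)"
  using assms
proof (induction l)
  case Nil
  then show ?case by simp
next
  case (Cons x l)
  then have "sorted_wrt (\<lambda>a b. g a < g b \<or> (g a = g b \<and> a < b)) (sort_key g l)"
    by simp
  then have "sorted_wrt (\<lambda>a b. g a < g b \<or> (g a = g b \<and> a < b)) (insort_key g x (sort_key g l))"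
    using Cons.prems by (intro sorted_wrt_insort_key_ties) auto
  then show ?case by simp
qed

lemma ranks_exists: "\<exists>s. ranks g lam s"
proof -
  define l where "l = sort_key g [1..<Suc lam]"
  define s where "s = (\<lambda>i. if i \<in> {1..lam} then l ! (i - 1) else i)"
  have len: "length l = lam" and dist: "distinct l" and set: "set l = {1..lam}"
    by (auto simp: l_def simp del: upt_Suc)
  have srt: "sorted_wrt (\<lambda>a b. g a < g b \<or> (g a = g b \<and> a < b)) l"
    unfolding l_def by (rule sorted_wrt_sort_key_ties) (rule sorted_wrt_upt)
  have "inj_on s {1..lam}"
    using dist len by (auto simp: s_def inj_on_def nth_eq_iff_index_eq)
  moreover have "s ` {1..lam} \<subseteq> {1..lam}"
  proof
    fix y assume "y \<in> s ` {1..lam}"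
    then obtain i where "i \<in> {1..lam}" "y = l ! (i - 1)" by (auto simp: s_def)
    then have "y \<in> set l" using len by (auto intro!: nth_mem)
    then show "y \<in> {1..lam}" using set by simp
  qed
  ultimately have "bij_betw s {1..lam} {1..lam}"
    by (simp add: bij_betw_def endo_inj_surj)
  then have "s permutes {1..lam}"
    by (rule bij_imp_permutes) (auto simp: s_def)
  moreover have "g (s i) < g (s j) \<or> (g (s i) = g (s j) \<and> s i < s j)"
    if "1 \<le> i" "i < j" "j \<le> lam" for i j
    using sorted_wrt_nth_less[OF srt, of "i - 1" "j - 1"] that len by (simp add: s_def)
  ultimately show ?thesis unfolding ranks_def by blast
qed

lemma ranks_unique:
  assumes s: "ranks g lam s" and t: "ranks g lam t"
  shows "s = t"
proof -
  have key: False
    if s: "ranks g lam s" and t: "ranks g lam t" and i: "1 \<le> i" "i \<le> lam"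
      and eq: "\<And>j. j < i \<Longrightarrow> s j = t j"
      and less: "g (s i) < g (t i) \<or> (g (s i) = g (t i) \<and> s i < t i)" for s t i
  proof -
    have sp: "s permutes {1..lam}" and tp: "t permutes {1..lam}"
      using s t by (auto simp: ranks_def)
    have "s i \<in> {1..lam}" using permutes_in_image[OF sp, of i] i by simp
    then obtain j where j: "j \<in> {1..lam}" "t j = s i"
      using permutes_image[OF tp] by (metis imageE)
    have "\<not> j < i" using eq[of j] j permutes_inj[OF sp] by (auto dest: injD)
    moreover have "j \<noteq> i" using j less by auto
    ultimately have "i < j" by simp
    then have "g (t i) < g (t j) \<or> (g (t i) = g (t j) \<and> t i < t j)"
      using t i j(1) unfolding ranks_def by (metis atLeastAtMost_iff)
    then show False using less j by auto
  qed
  have "s i = t i" for i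
  proof (induction i rule: less_induct)
    case (less i)
    show ?case
    proof (cases "i \<in> {1..lam}")
      case True
      then show ?thesis
        using key[OF s t, of i] key[OF t s, of i] less by fastforce
    next
      case False
      then show ?thesis using s t by (auto simp: ranks_def permutes_def)
    qed
  qed
  then show ?thesis by blast
qed

lemma ranks_ex1: "\<exists>!s. ranks g lam s"
  using ranks_exists ranks_unique by blast

definition es_move ::
  "(real ^ 'd \<Rightarrow> real) \<Rightarrow> nat \<Rightarrow> nat \<Rightarrow> (nat \<Rightarrow> real) \<Rightarrow> real ^ 'd \<Rightarrow> real \<Rightarrow> (nat \<Rightarrow> real ^ 'd) \<Rightarrow> real ^ 'd"
where
  "es_move f lam mu w m \<sigma> u =
     (\<Sum>i=1..mu. w i *\<^sub>R u (ranking (\<lambda>j. f (m + \<sigma> *\<^sub>R u j)) lam i))"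

definition mu_eff :: "nat \<Rightarrow> (nat \<Rightarrow> real) \<Rightarrow> real" where
  "mu_eff mu w = (\<Sum>i=1..mu. (w i)\<^sup>2)"

definition es_factor :: "nat \<Rightarrow> (nat \<Rightarrow> real) \<Rightarrow> real \<Rightarrow> real ^ 'd \<Rightarrow> real" where
  "es_factor mu w ds v =
     exp ((1 / ds) * (sqrt (mu_eff mu w) * norm v
            / (\<integral>x. norm (x :: real ^ 'd) \<partial>std_normal_vec) - 1))"

text \<open>One iteration, from the state \<open>(m, \<sigma>)\<close> with sampled directions \<open>u 1, \<dots>, u lam\<close>.\<close>

definition es_step ::
  "(real ^ 'd \<Rightarrow> real) \<Rightarrow> nat \<Rightarrow> nat \<Rightarrow> (nat \<Rightarrow> real) \<Rightarrow> real
     \<Rightarrow> (real ^ 'd) \<times> real \<Rightarrow> (nat \<Rightarrow> real ^ 'd) \<Rightarrow> (real ^ 'd) \<times> real"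
where
  "es_step f lam mu w ds = (\<lambda>(m, \<sigma>) u.
     (m + \<sigma> *\<^sub>R es_move f lam mu w m \<sigma> u,
      \<sigma> * es_factor mu w ds (es_move f lam mu w m \<sigma> u)))"

text \<open>\<open>U k i\<close> is the \<open>i\<close>-th direction used to produce the state \<open>k\<close>; only \<open>k \<ge> 1\<close> and
  \<open>1 \<le> i \<le> lam\<close> matter. The initial state is random with an arbitrary distribution.\<close>

locale adaptive_es = prob_space M
  for M :: "'w measure" +
  fixes f :: "real ^ 'd \<Rightarrow> real"
    and lam mu :: nat
    and w :: "nat \<Rightarrow> real"
    and ds :: real
    and m :: "nat \<Rightarrow> 'w \<Rightarrow> real ^ 'd"
    and \<sigma> :: "nat \<Rightarrow> 'w \<Rightarrow> real"
    and U :: "nat \<Rightarrow> nat \<Rightarrow> 'w \<Rightarrow> real ^ 'd"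
  assumes m_measurable: "random_variable borel (m k)"
    and \<sigma>_measurable: "random_variable borel (\<sigma> k)"
    and \<sigma>_init_pos: "\<omega> \<in> space M \<Longrightarrow> \<sigma> 0 \<omega> > 0"
    and U_measurable: "i \<in> {1..lam} \<Longrightarrow> random_variable borel (U (Suc k) i)"
    and U_normal: "i \<in> {1..lam} \<Longrightarrow> distr M borel (U (Suc k) i) = std_normal_vec"
    and U_indep: "indep_vars (\<lambda>_. borel) (U (Suc k)) {1..lam}"
    and U_indep_past:
      "indep_set
         (sets (vimage_algebra (space M)
           (\<lambda>\<omega>. (\<lambda>j\<in>{..k}. (m j \<omega>, \<sigma> j \<omega>), \<lambda>(j, i)\<in>{1..k} \<times> {1..lam}. U j i \<omega>))
           (PiM {..k} (\<lambda>_. borel) \<Otimes>\<^sub>M PiM ({1..k} \<times> {1..lam}) (\<lambda>_. borel))))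
         (sets (vimage_algebra (space M)
           (\<lambda>\<omega>. \<lambda>i\<in>{1..lam}. U (Suc k) i \<omega>) (PiM {1..lam} (\<lambda>_. borel))))"
    and update: "\<omega> \<in> space M \<Longrightarrow>
      (m (Suc k) \<omega>, \<sigma> (Suc k) \<omega>) =
        es_step f lam mu w ds (m k \<omega>, \<sigma> k \<omega>) (\<lambda>i. U (Suc k) i \<omega>)"

definition normalized :: "real ^ 'd \<Rightarrow> (real ^ 'd) \<times> real \<Rightarrow> real ^ 'd" where
  "normalized xs = (\<lambda>(m, \<sigma>). (1 / \<sigma>) *\<^sub>R (m - xs))"

text \<open>The law of the next normalized state, given the current one \<open>z\<close>: perform one iteration from
  the representative \<open>(xs + z, 1)\<close> of \<open>z\<close>. For scaling-invariant \<open>f\<close> any other representative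
  \<open>(xs + \<sigma> z, \<sigma>)\<close> yields the same law.\<close>

definition normalized_kernel ::
  "(real ^ 'd \<Rightarrow> real) \<Rightarrow> nat \<Rightarrow> nat \<Rightarrow> (nat \<Rightarrow> real) \<Rightarrow> real \<Rightarrow> real ^ 'd
     \<Rightarrow> real ^ 'd \<Rightarrow> (real ^ 'd) measure"
where
  "normalized_kernel f lam mu w ds xs z =
     distr (PiM {1..lam} (\<lambda>_. std_normal_vec)) borel
       (\<lambda>u. normalized xs (es_step f lam mu w ds (xs + z, 1) u))"

section \<open>Markov chains on a topological space\<close>

definition markov_kernel :: "('a::topological_space \<Rightarrow> 'a measure) \<Rightarrow> bool" where
  "markov_kernel P \<longleftrightarrow> P \<in> borel \<rightarrow>\<^sub>M prob_algebra borel"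

text \<open>The Markov property is with respect to the natural filtration
  \<open>\<sigma>(z\<^sub>0, \<dots>, z\<^sub>k)\<close>; the same kernel serves all times \<open>k\<close>.\<close>

definition homogeneous_markov_chain ::
  "'w measure \<Rightarrow> (nat \<Rightarrow> 'w \<Rightarrow> 'a::topological_space) \<Rightarrow> ('a \<Rightarrow> 'a measure) \<Rightarrow> bool"
where
  "homogeneous_markov_chain M z P \<longleftrightarrow>
     prob_space M \<and> markov_kernel P \<and> (\<forall>k. z k \<in> M \<rightarrow>\<^sub>M borel) \<and>
     (\<forall>k. \<forall>A\<in>sets borel. AE \<omega> in M.
        real_cond_exp M
          (vimage_algebra (space M) (\<lambda>\<omega>. \<lambda>j\<in>{..k}. z j \<omega>) (PiM {..k} (\<lambda>_. borel)))
          (\<lambda>\<omega>. indicator A (z (Suc k) \<omega>)) \<omega>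
        = measure (P (z k \<omega>)) A)"

primrec kernel_pow ::
  "('a::topological_space \<Rightarrow> 'a measure) \<Rightarrow> nat \<Rightarrow> 'a \<Rightarrow> 'a measure"
where
  "kernel_pow P 0 x = return borel x"
| "kernel_pow P (Suc k) x = P x \<bind> kernel_pow P k"

definition irreducibility_measure ::
  "('a::topological_space \<Rightarrow> 'a measure) \<Rightarrow> 'a measure \<Rightarrow> bool"
where
  "irreducibility_measure P \<phi> \<longleftrightarrow>
     sets \<phi> = sets borel \<and> emeasure \<phi> UNIV \<noteq> 0 \<and>
     (\<forall>A\<in>sets borel. emeasure \<phi> A > 0 \<longrightarrow>
        (\<forall>x. (\<Sum>k. emeasure (kernel_pow P (Suc k) x) A) > 0))"

definition phi_irreducible :: "('a::topological_space \<Rightarrow> 'a measure) \<Rightarrow> bool" where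
  "phi_irreducible P \<longleftrightarrow> (\<exists>\<phi>. irreducibility_measure P \<phi>)"

definition sampled_kernel ::
  "('a::topological_space \<Rightarrow> 'a measure) \<Rightarrow> nat pmf \<Rightarrow> 'a \<Rightarrow> 'a set \<Rightarrow> ennreal"
where
  "sampled_kernel P b x A = (\<Sum>k. ennreal (pmf b k) * emeasure (kernel_pow P k x) A)"

definition lower_semicontinuous :: "('a::topological_space \<Rightarrow> 'b::linorder) \<Rightarrow> bool" where
  "lower_semicontinuous g \<longleftrightarrow> (\<forall>t. open {x. t < g x})"

definition T_chain :: "('a::topological_space \<Rightarrow> 'a measure) \<Rightarrow> bool" where
  "T_chain P \<longleftrightarrow>
     (\<exists>b T. T \<in> borel \<rightarrow>\<^sub>M subprob_algebra borel \<and>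
        (\<forall>x. \<forall>A\<in>sets borel. emeasure (T x) A \<le> sampled_kernel P b x A) \<and>
        (\<forall>A\<in>sets borel. lower_semicontinuous (\<lambda>x. emeasure (T x) A)) \<and>
        (\<forall>x. emeasure (T x) UNIV > 0))"

definition small_set :: "('a::topological_space \<Rightarrow> 'a measure) \<Rightarrow> 'a set \<Rightarrow> bool" where
  "small_set P C \<longleftrightarrow> C \<in> sets borel \<and>
     (\<exists>a \<nu>. sets \<nu> = sets borel \<and> emeasure \<nu> UNIV \<noteq> 0 \<and>
        (\<forall>x\<in>C. \<forall>A\<in>sets borel. emeasure \<nu> A \<le> emeasure (kernel_pow P a x) A))"

text \<open>The residues modulo \<open>n\<close> are represented by \<open>0, \<dots>, n - 1\<close>.\<close>

definition cycle ::
  "('a::topological_space \<Rightarrow> 'a measure) \<Rightarrow> nat \<Rightarrow> (nat \<Rightarrow> 'a set) \<Rightarrow> bool"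
where
  "cycle P n D \<longleftrightarrow> n \<ge> 1 \<and> (\<forall>i<n. D i \<in> sets borel) \<and> disjoint_family_on D {..<n} \<and>
     (\<forall>i<n. \<forall>x\<in>D i. emeasure (P x) (D (Suc i mod n)) = 1) \<and>
     (\<forall>\<phi>. irreducibility_measure P \<phi> \<longrightarrow> emeasure \<phi> (- (\<Union>i<n. D i)) = 0)"

definition aperiodic_chain :: "('a::topological_space \<Rightarrow> 'a measure) \<Rightarrow> bool" where
  "aperiodic_chain P \<longleftrightarrow> phi_irreducible P \<and>
     (\<exists>D. cycle P 1 D) \<and> (\<forall>n D. cycle P n D \<longrightarrow> n \<le> 1)"

end

theory Submission
  imports Defs
begin

text \<open>
  The minorizing measure \<open>\<nu>\<close> is Lebesgue measure on one fixed ball. Since level sets of \<open>f\<close>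
  are negligible, \<open>f\<close> is not constant on any ball, so near every direction there are \<open>lam\<close> directions
  with strictly increasing objective values; for samples close to them the ranking is the identity, and
  this persists for nearby states. Choosing them near \<open>- z\<close> sends \<open>z\<close> into any given neighbourhood of
  \<open>0\<close> in one step, with probability bounded below on compact sets. From a small neighbourhood of \<open>0\<close>
  the next state is \<open>exp (1 / ds - \<kappa> * norm v) *\<^sub>R (z + v)\<close>, whose dependence on \<open>v\<close> is Lipschitz and,
  near a suitable nonzero point, onto a fixed ball; by the Vitali covering theorem the kernel then
  dominates a multiple of \<open>\<nu>\<close>. Hence both the second and the third power of the kernel dominate a
  multiple of \<open>\<nu>\<close> uniformly on compact sets, which gives small sets, irreducibility, aperiodicity
  and, with the two-step kernel, the T-chain property.
\<close>

section \<open>Kernels minorized on compact sets\<close>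

lemma measurable_kernel_pow:
  assumes "markov_kernel P"
  shows "kernel_pow P k \<in> borel \<rightarrow>\<^sub>M prob_algebra borel"
proof (induction k)
  case 0
  have "kernel_pow P 0 = return borel" by (rule ext) simp
  then show ?case by simp
next
  case (Suc k)
  have "kernel_pow P (Suc k) = (\<lambda>x. P x \<bind> kernel_pow P k)" by (rule ext) simp
  then show ?case using assms Suc by (simp add: markov_kernel_def measurable_bind_prob_space)
qed

lemma
  assumes "markov_kernel P"
  shows sets_kernel_pow: "sets (kernel_pow P k x) = sets borel"
    and prob_space_kernel_pow: "prob_space (kernel_pow P k x)"
  using measurable_space[OF measurable_kernel_pow[OF assms], of x k]
  by (auto simp: space_prob_algebra)

lemma
  assumes "markov_kernel P"
  shows sets_markov_kernel: "sets (P x) = sets borel"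
    and prob_space_markov_kernel: "prob_space (P x)"
  using measurable_space[of P borel "prob_algebra borel" x] assms
  by (auto simp: space_prob_algebra markov_kernel_def)

lemma emeasure_kernel_pow_Suc:
  assumes "markov_kernel P" "A \<in> sets borel"
  shows "emeasure (kernel_pow P (Suc k) x) A = (\<integral>\<^sup>+y. emeasure (kernel_pow P k y) A \<partial>P x)"
proof -
  have "P x \<in> space (prob_algebra borel)"
    using assms(1) by (simp add: space_prob_algebra sets_markov_kernel prob_space_markov_kernel)
  then show ?thesis
    using emeasure_bind_prob_algebra[OF _ measurable_kernel_pow[OF assms(1)] assms(2)] by simp
qed

lemma emeasure_kernel_pow_1:
  assumes "markov_kernel P" "A \<in> sets borel"
  shows "emeasure (kernel_pow P (Suc 0) x) A = emeasure (P x) A"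
  using assms sets_markov_kernel[OF assms(1), of x] by (simp add: bind_return'' cong: bind_cong)

text \<open>Chapman-Kolmogorov with the first transition restricted to \<open>D\<close>. Since
  \<open>q\<close> is uniform over \<open>D\<close>, lower bounds for successive transitions
  multiply, which is how the bounds at times two and three are built later.\<close>

lemma kernel_pow_Suc_ge:
  assumes P: "markov_kernel P" and D: "D \<in> sets borel" and A: "A \<in> sets borel"
    and p: "p \<le> emeasure (P x) D" and q: "\<And>y. y \<in> D \<Longrightarrow> q \<le> emeasure (kernel_pow P k y) A"
  shows "p * q \<le> emeasure (kernel_pow P (Suc k) x) A"
proof -
  have "p * q \<le> q * emeasure (P x) D" using p by (subst mult.commute) (rule mult_left_mono, auto)
  also have "\<dots> = (\<integral>\<^sup>+y. q * indicator D y \<partial>P x)"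
    using D P by (simp add: nn_integral_cmult_indicator sets_markov_kernel)
  also have "\<dots> \<le> (\<integral>\<^sup>+y. emeasure (kernel_pow P k y) A \<partial>P x)"
    using q by (intro nn_integral_mono) (auto split: split_indicator)
  finally show ?thesis using emeasure_kernel_pow_Suc[OF P A] by simp
qed

text \<open>Iterates are peeled off at the first transition, so the induction has to range over all
  classes \<open>j\<close> and all starting points in them.\<close>

lemma cycle_kernel_pow:
  assumes P: "markov_kernel P" and D: "cycle P n D" and "j < n" "x \<in> D j"
  shows "emeasure (kernel_pow P k x) (D ((j + k) mod n)) = 1"
  using assms(3,4)
proof (induction k arbitrary: j x)
  case 0
  then show ?case using D by (simp add: cycle_def)
next
  case (Suc k)
  let ?j = "Suc j mod n"
  have j: "?j < n" using Suc.prems by simp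
  have eq: "(?j + k) mod n = (j + Suc k) mod n" by (simp add: mod_add_left_eq)
  have b: "D i \<in> sets borel" if "i < n" for i using D that by (simp add: cycle_def)
  have "1 * 1 \<le> emeasure (kernel_pow P (Suc k) x) (D ((j + Suc k) mod n))"
  proof (rule kernel_pow_Suc_ge[OF P b[OF j]])
    show "1 \<le> emeasure (P x) (D ?j)" using D Suc.prems by (simp add: cycle_def)
    show "1 \<le> emeasure (kernel_pow P k y) (D ((j + Suc k) mod n))" if "y \<in> D ?j" for y
      using Suc.IH[OF j that] by (simp add: eq)
  qed (use b Suc.prems in auto)
  moreover have "emeasure (kernel_pow P (Suc k) x) (D ((j + Suc k) mod n)) \<le> 1"
    using prob_space.measure_le_1[OF prob_space_kernel_pow[OF P]] by blast
  ultimately show ?case by simp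
qed

text \<open>Small sets with a common minorizing measure at two consecutive times rule out periods
  greater than one.\<close>

locale minorized_kernel =
  fixes P :: "'a::euclidean_space \<Rightarrow> 'a measure" and \<nu> :: "'a measure" and a :: nat
  assumes P: "markov_kernel P" and a: "a \<ge> 1"
    and sets_\<nu>: "sets \<nu> = sets borel" and \<nu>: "emeasure \<nu> UNIV \<noteq> 0"
    and minorization: "\<And>C. compact C \<Longrightarrow> \<exists>\<epsilon>>0. \<forall>x\<in>C. \<forall>A\<in>sets borel.
      \<epsilon> * emeasure \<nu> A \<le> emeasure (kernel_pow P a x) A \<and>
      \<epsilon> * emeasure \<nu> A \<le> emeasure (kernel_pow P (Suc a) x) A"
begin

lemma minorized_at:
  obtains \<epsilon> where "\<epsilon> > 0"
    "\<And>A. A \<in> sets borel \<Longrightarrow> \<epsilon> * emeasure \<nu> A \<le> emeasure (kernel_pow P a x) A"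
    "\<And>A. A \<in> sets borel \<Longrightarrow> \<epsilon> * emeasure \<nu> A \<le> emeasure (kernel_pow P (Suc a) x) A"
  using minorization[of "{x}"] by auto

text \<open>Minorization on the compact set \<open>{x}\<close> already makes one summand of the
  series positive.\<close>

lemma irreducibility_measure: "irreducibility_measure P \<nu>"
  unfolding irreducibility_measure_def
proof (intro conjI ballI impI allI sets_\<nu> \<nu>)
  fix A x assume A: "A \<in> sets borel" "emeasure \<nu> A > 0"
  obtain \<epsilon> where \<epsilon>: "\<epsilon> > 0"
    "\<And>A. A \<in> sets borel \<Longrightarrow> \<epsilon> * emeasure \<nu> A \<le> emeasure (kernel_pow P (Suc a) x) A"
    using minorized_at[of x] by metis
  have "0 < \<epsilon> * emeasure \<nu> A" using A \<epsilon> by (simp add: ennreal_zero_less_mult_iff)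
  also have "\<dots> \<le> emeasure (kernel_pow P (Suc a) x) A" using \<epsilon> A by simp
  \<comment> \<open>The series starts at time one, so the bound at time \<open>Suc a\<close> is its
    summand with index \<open>a\<close>.\<close>
  also have "\<dots> = (\<Sum>k\<in>{a}. emeasure (kernel_pow P (Suc k) x) A)" by simp
  also have "\<dots> \<le> (\<Sum>k. emeasure (kernel_pow P (Suc k) x) A)" by (intro sum_le_suminf) auto
  finally show "0 < (\<Sum>k. emeasure (kernel_pow P (Suc k) x) A)" .
qed

lemma phi_irreducible: "phi_irreducible P"
  using irreducibility_measure by (auto simp: phi_irreducible_def)

lemma small_set:
  assumes "compact C"
  shows "small_set P C"
proof -
  obtain \<epsilon> where \<epsilon>: "\<epsilon> > 0" "\<forall>x\<in>C. \<forall>A\<in>sets borel. \<epsilon> * emeasure \<nu> A \<le> emeasure (kernel_pow P a x) A"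
    using minorization[OF assms] by blast
  have "emeasure (scale_measure \<epsilon> \<nu>) UNIV \<noteq> 0" using \<epsilon> \<nu> by simp
  then show ?thesis
    unfolding small_set_def using \<epsilon> assms sets_\<nu>
    by (intro conjI exI[of _ a] exI[of _ "scale_measure \<epsilon> \<nu>"]) (auto intro: borel_compact)
qed

text \<open>From a point of a cycle the chain is surely in one class at time \<open>a\<close> and in
  the next class at time \<open>Suc a\<close>. Both laws dominate a positive multiple of
  \<open>\<nu>\<close>, so \<open>\<nu>\<close> vanishes outside either class. If the two classes
  were disjoint, their complements would cover the space and \<open>\<nu>\<close> would be
  zero.\<close>

lemma cycle_le_1:
  assumes D: "cycle P n D"
  shows "n \<le> 1"
proof (rule ccontr)
  assume "\<not> n \<le> 1"
  then have n: "n \<ge> 2" by simp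
  have sets_D: "D i \<in> sets borel" if "i < n" for i using D that by (simp add: cycle_def)
  \<comment> \<open>As \<open>\<nu>\<close> is itself an irreducibility measure, the cycle exhausts
    it up to a null set; this provides a point to start from.\<close>
  have "emeasure \<nu> (- (\<Union>i<n. D i)) = 0"
    using D irreducibility_measure by (simp add: cycle_def)
  then have "(\<Union>i<n. D i) \<noteq> {}" using \<nu> by (metis Compl_empty_eq)
  then obtain j x where x: "j < n" "x \<in> D j" by auto
  obtain \<epsilon> where \<epsilon>: "\<epsilon> > 0"
    "\<And>A. A \<in> sets borel \<Longrightarrow> \<epsilon> * emeasure \<nu> A \<le> emeasure (kernel_pow P a x) A"
    "\<And>A. A \<in> sets borel \<Longrightarrow> \<epsilon> * emeasure \<nu> A \<le> emeasure (kernel_pow P (Suc a) x) A"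
    using minorized_at[of x] by metis
  have null: "emeasure \<nu> (- D ((j + k) mod n)) = 0"
    if "\<And>A. A \<in> sets borel \<Longrightarrow> \<epsilon> * emeasure \<nu> A \<le> emeasure (kernel_pow P k x) A" for k
  proof -
    interpret Pk: prob_space "kernel_pow P k x" by (rule prob_space_kernel_pow[OF P])
    let ?D = "D ((j + k) mod n)"
    have DB: "?D \<in> sets borel" using n by (intro sets_D) simp
    have sp: "space (kernel_pow P k x) = UNIV"
      using sets_eq_imp_space_eq[OF sets_kernel_pow[OF P, of k x]] by simp
    have "emeasure (kernel_pow P k x) (- ?D)
        = emeasure (kernel_pow P k x) (space (kernel_pow P k x)) - emeasure (kernel_pow P k x) ?D"
      using DB sets_kernel_pow[OF P, of k x] cycle_kernel_pow[OF P D x, of k]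
      by (subst emeasure_compl[symmetric]) (auto simp: sp Compl_eq_Diff_UNIV)
    also have "\<dots> = 0" using cycle_kernel_pow[OF P D x, of k] by (simp add: Pk.emeasure_space_1)
    finally have "\<epsilon> * emeasure \<nu> (- ?D) \<le> 0" using that[of "- ?D"] DB by simp
    then show ?thesis using \<epsilon>(1) by auto
  qed
  let ?p = "(j + a) mod n" and ?q = "(j + Suc a) mod n"
  have ne: "?p \<noteq> ?q" using n by (auto simp: mod_Suc)
  have "?p < n" "?q < n" using n by auto
  then have "D ?p \<inter> D ?q = {}" and B: "D ?p \<in> sets \<nu>" "D ?q \<in> sets \<nu>"
    using D ne sets_D sets_\<nu> by (auto simp: cycle_def disjoint_family_on_def)
  then have "UNIV = - D ?p \<union> - D ?q" by blast
  then have "emeasure \<nu> UNIV \<le> emeasure \<nu> (- D ?p) + emeasure \<nu> (- D ?q)"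
    using B sets_\<nu> by (metis emeasure_subadditive borel_comp)
  also have "\<dots> = 0" using null[of a] null[of "Suc a"] \<epsilon> by simp
  finally show False using \<nu> by simp
qed

lemma aperiodic_chain: "aperiodic_chain P"
proof -
  have "emeasure (P x) UNIV = 1" for x
    using prob_space.emeasure_space_1[OF prob_space_markov_kernel[OF P, of x]]
      sets_eq_imp_space_eq[OF sets_markov_kernel[OF P, of x]] by simp
  then have "cycle P 1 (\<lambda>_. UNIV)"
    by (auto simp: cycle_def disjoint_family_on_def irreducibility_measure_def)
  then show ?thesis
    using phi_irreducible cycle_le_1 unfolding aperiodic_chain_def by blast
qed

text \<open>The continuous component is \<open>g x\<close> times \<open>\<nu>\<close>, where
  \<open>g\<close> takes the best of the constants available on the balls around the origin that
  contain \<open>x\<close>. The sampling distribution is the point mass at \<open>a\<close>.\<close>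

lemma T_chain: "T_chain P"
proof -
  have "\<exists>\<epsilon>>0. \<forall>x\<in>cball 0 (real n). \<forall>A\<in>sets borel. \<epsilon> * emeasure \<nu> A \<le> emeasure (kernel_pow P a x) A" for n
    using minorization[OF compact_cball, of 0 "real n"] by blast
  then obtain \<epsilon> :: "nat \<Rightarrow> ennreal" where \<epsilon>: "\<And>n. \<epsilon> n > 0"
    "\<And>n x A. x \<in> cball 0 (real n) \<Longrightarrow> A \<in> sets borel \<Longrightarrow> \<epsilon> n * emeasure \<nu> A \<le> emeasure (kernel_pow P a x) A"
    by metis
  \<comment> \<open>Closed balls were needed for compactness; open balls are used here so that
    \<open>g\<close>, a supremum of multiples of indicators of open sets, is lower
    semicontinuous.\<close>
  define g where "g x = (SUP n\<in>{n. x \<in> ball 0 (real n)}. \<epsilon> n)" for x :: 'a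
  define T where "T x = scale_measure (g x) \<nu>" for x
  have ne: "{n. x \<in> ball 0 (real n)} \<noteq> {}" for x :: 'a
    using reals_Archimedean2[of "norm x"] by auto
  have em: "emeasure (T x) A = (SUP n\<in>{n. x \<in> ball 0 (real n)}. \<epsilon> n * emeasure \<nu> A)" for x A
    by (simp add: T_def g_def SUP_mult_right_ennreal)
  have le: "emeasure (T x) A \<le> emeasure (kernel_pow P a x) A" if "A \<in> sets borel" for x A
    unfolding em using \<epsilon>(2) that by (intro SUP_least) auto
  have lsc: "lower_semicontinuous (\<lambda>x. emeasure (T x) A)" for A
    unfolding lower_semicontinuous_def
  proof
    fix t
    have "{x. t < emeasure (T x) A} = (\<Union>n\<in>{n. t < \<epsilon> n * emeasure \<nu> A}. ball 0 (real n))"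
      by (auto simp: em less_SUP_iff)
    then show "open {x. t < emeasure (T x) A}" by auto
  qed
  have meas: "T \<in> borel \<rightarrow>\<^sub>M subprob_algebra borel"
  proof (rule measurable_subprob_algebra)
    fix x
    have sT: "sets (T x) = sets borel" by (simp add: T_def sets_\<nu>)
    then have "space (T x) = UNIV" using sets_eq_imp_space_eq by fastforce
    then show "subprob_space (T x)"
      using le[of UNIV x] prob_space.measure_le_1[OF prob_space_kernel_pow[OF P], of a x UNIV]
      by (intro subprob_spaceI) auto
    show "sets (T x) = sets borel" by fact
  next
    fix A :: "'a set"
    show "(\<lambda>x. emeasure (T x) A) \<in> borel_measurable borel"
      using lsc[of A] by (intro borel_measurableI_greater) (auto simp: lower_semicontinuous_def)
  qed
  have samp: "sampled_kernel P (return_pmf a) x A = emeasure (kernel_pow P a x) A" for x A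
  proof -
    have "sampled_kernel P (return_pmf a) x A
        = (\<Sum>k\<in>{a}. ennreal (pmf (return_pmf a) k) * emeasure (kernel_pow P k x) A)"
      unfolding sampled_kernel_def by (rule suminf_finite) (auto simp: indicator_def)
    then show ?thesis by simp
  qed
  have pos: "emeasure (T x) UNIV > 0" for x
  proof -
    obtain n where "x \<in> ball 0 (real n)" using ne[of x] by auto
    moreover have "0 < \<epsilon> n * emeasure \<nu> UNIV" using \<epsilon>(1) \<nu> by (simp add: ennreal_zero_less_mult_iff zero_less_iff_neq_zero)
    ultimately show ?thesis unfolding em by (auto simp: less_SUP_iff)
  qed
  show ?thesis
    unfolding T_chain_def using meas le lsc pos
    by (intro exI[of _ "return_pmf a"] exI[of _ T]) (auto simp: samp)
qed

end

section \<open>Domination of Lebesgue measure\<close>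

text \<open>By outer regularity of the finite measure \<open>\<mu>\<close> it suffices to compare
  with open \<open>U\<close> containing \<open>A\<close>. Small balls centred in \<open>A\<close>
  and contained in \<open>U\<close> form a Vitali cover, so countably many disjoint ones fill
  \<open>A\<close> up to a null set, and the bounds on these balls add up.\<close>

lemma emeasure_lborel_le_of_balls:
  fixes \<mu> :: "'a::euclidean_space measure"
  assumes \<mu>: "sets \<mu> = sets borel" "finite_measure \<mu>" and "0 < \<epsilon>0"
    and balls: "\<And>y \<epsilon>. y \<in> B \<Longrightarrow> 0 < \<epsilon> \<Longrightarrow> \<epsilon> < \<epsilon>0 \<Longrightarrow>
      c * emeasure lborel (ball y \<epsilon>) \<le> emeasure \<mu> (ball y \<epsilon>)"
    and A: "A \<in> sets borel" "A \<subseteq> B"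
  shows "c * emeasure lborel A \<le> emeasure \<mu> A"
proof -
  have "c * emeasure lborel A \<le> emeasure \<mu> U" if U: "A \<subseteq> U" "open U" for U
  proof -
    define K where "K = {(y, \<epsilon>). y \<in> A \<and> 0 < \<epsilon> \<and> \<epsilon> < \<epsilon>0 \<and> ball y \<epsilon> \<subseteq> U}"
    have "\<exists>i. i \<in> K \<and> x \<in> ball (fst i) (snd i) \<and> snd i < d" if x: "x \<in> A" "0 < d" for x d
    proof -
      have "x \<in> U" using U x by auto
      then obtain e where e: "e > 0" "ball x e \<subseteq> U" by (rule openE[OF U(2)])
      \<comment> \<open>The radius has to stay inside \<open>U\<close>, in the range of the
        hypothesis \<open>balls\<close>, and below the prescribed fineness \<open>d\<close>.\<close>
      have "(x, min (e / 2) (min (\<epsilon>0 / 2) (d / 2))) \<in> K"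
        using e x \<open>0 < \<epsilon>0\<close> by (auto simp: K_def subset_iff)
      then show ?thesis
        using e x \<open>0 < \<epsilon>0\<close> by (intro exI[of _ "(x, min (e / 2) (min (\<epsilon>0 / 2) (d / 2)))"]) auto
    qed
    then have cov: "\<And>x d. x \<in> A \<Longrightarrow> 0 < d \<Longrightarrow> \<exists>i. i \<in> K \<and> x \<in> ball (fst i) (snd i) \<and> snd i < d"
      by blast
    obtain C where C: "countable C" "C \<subseteq> K"
      "pairwise (\<lambda>i j. disjnt (ball (fst i) (snd i)) (ball (fst j) (snd j))) C"
      "negligible (A - (\<Union>i\<in>C. ball (fst i) (snd i)))"
      by (rule Vitali_covering_theorem_balls[of A K fst snd, OF cov])
    have dis: "disjoint_family_on (\<lambda>i. ball (fst i) (snd i)) C"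
      using C(3) by (auto simp: disjoint_family_on_def pairwise_def disjnt_def)
    have UB: "(\<Union>i\<in>C. ball (fst i) (snd i)) \<in> sets borel"
      by (intro borel_open open_UN) auto
    have "emeasure lborel A \<le> emeasure lborel
        ((A - (\<Union>i\<in>C. ball (fst i) (snd i))) \<union> (\<Union>i\<in>C. ball (fst i) (snd i)))"
      using A UB by (intro emeasure_mono) auto
    also have "\<dots> \<le> emeasure lborel (A - (\<Union>i\<in>C. ball (fst i) (snd i)))
        + emeasure lborel (\<Union>i\<in>C. ball (fst i) (snd i))"
      using A UB by (intro emeasure_subadditive) auto
    also have "emeasure lborel (A - (\<Union>i\<in>C. ball (fst i) (snd i))) = 0"
      using C(4) A UB by (auto simp: negligible_iff_null_sets null_sets_completion_iff)
    finally have "c * emeasure lborel A \<le> c * emeasure lborel (\<Union>i\<in>C. ball (fst i) (snd i))"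
      by (intro mult_left_mono) auto
    also have "\<dots> = (\<integral>\<^sup>+i. c * emeasure lborel (ball (fst i) (snd i)) \<partial>count_space C)"
      using C(1) dis by (subst emeasure_UN_countable) (auto simp: nn_integral_cmult)
    also have "\<dots> \<le> (\<integral>\<^sup>+i. emeasure \<mu> (ball (fst i) (snd i)) \<partial>count_space C)"
      using C(2) A(2) by (intro nn_integral_mono balls) (auto simp: K_def)
    also have "\<dots> = emeasure \<mu> (\<Union>i\<in>C. ball (fst i) (snd i))"
      using C(1) dis \<mu>(1) by (subst emeasure_UN_countable) auto
    also have "(\<Union>i\<in>C. ball (fst i) (snd i)) \<subseteq> U"
      using C(2) by (fastforce simp: K_def)
    then have "emeasure \<mu> (\<Union>i\<in>C. ball (fst i) (snd i)) \<le> emeasure \<mu> U"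
      using U \<mu>(1) by (intro emeasure_mono) auto
    finally show ?thesis .
  qed
  then show ?thesis
    using outer_regular[OF \<mu>(1) _ A(1)] finite_measure.emeasure_finite[OF \<mu>(2)]
    by (auto intro!: INF_greatest)
qed

section \<open>Damped shifts\<close>

text \<open>The inequality \<open>1 + t \<le> exp t\<close> at \<open>t = y - x\<close> bounds the
  increment by the larger of the two exponentials, hence by \<open>exp b\<close>.\<close>

lemma exp_diff_abs_le:
  fixes x y b :: real
  assumes "x \<le> b" "y \<le> b"
  shows "\<bar>exp x - exp y\<bar> \<le> exp b * \<bar>x - y\<bar>"
proof -
  have *: "exp x - exp y \<le> exp b * (x - y)" if "y \<le> x" "x \<le> b" for x y :: real
  proof -
    have "1 - exp (y - x) \<le> x - y" using exp_ge_add_one_self[of "y - x"] by linarith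
    then have "exp x * (1 - exp (y - x)) \<le> exp x * (x - y)" by simp
    then have "exp x - exp y \<le> exp x * (x - y)" by (simp add: exp_diff right_diff_distrib)
    also have "\<dots> \<le> exp b * (x - y)" using that by (intro mult_right_mono) auto
    finally show ?thesis .
  qed
  show ?thesis
    using *[of x y] *[of y x] assms by (cases "y \<le> x") (auto simp: abs_if)
qed

text \<open>The difference splits into the factor at \<open>v'\<close> times \<open>v' - v\<close>
  and the change of the factor times \<open>z + v\<close>. Only \<open>z + v\<close> is multiplied
  by a varying factor, so \<open>K\<close> has to control just one of the two points.\<close>

lemma damped_shift_lipschitz:
  fixes v v' z :: "'a::real_normed_vector"
  assumes \<kappa>: "0 \<le> \<kappa>" and K: "norm (z + v) \<le> K"
  shows "norm (exp (b - \<kappa> * norm v') *\<^sub>R (z + v') - exp (b - \<kappa> * norm v) *\<^sub>R (z + v))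
           \<le> exp b * (1 + \<kappa> * K) * norm (v' - v)"
proof -
  let ?e = "\<lambda>v. exp (b - \<kappa> * norm v)"
  have K0: "0 \<le> K" using K norm_ge_zero order_trans by blast
  have "\<bar>?e v' - ?e v\<bar> \<le> exp b * \<bar>(b - \<kappa> * norm v') - (b - \<kappa> * norm v)\<bar>"
    using \<kappa> by (intro exp_diff_abs_le) auto
  also have "(b - \<kappa> * norm v') - (b - \<kappa> * norm v) = - (\<kappa> * (norm v' - norm v))"
    by (simp add: right_diff_distrib)
  also have "exp b * \<bar>- (\<kappa> * (norm v' - norm v))\<bar> = exp b * \<kappa> * \<bar>norm v' - norm v\<bar>"
    using \<kappa> by (simp add: abs_mult)
  also have "\<dots> \<le> exp b * \<kappa> * norm (v' - v)"
    using \<kappa> norm_triangle_ineq3 by (intro mult_left_mono) auto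
  finally have e: "\<bar>?e v' - ?e v\<bar> \<le> exp b * \<kappa> * norm (v' - v)" .
  have "?e v' *\<^sub>R (z + v') - ?e v *\<^sub>R (z + v) = ?e v' *\<^sub>R (v' - v) + (?e v' - ?e v) *\<^sub>R (z + v)"
    by (simp add: algebra_simps)
  then have "norm (?e v' *\<^sub>R (z + v') - ?e v *\<^sub>R (z + v))
      \<le> ?e v' * norm (v' - v) + \<bar>?e v' - ?e v\<bar> * norm (z + v)"
    using norm_triangle_ineq[of "?e v' *\<^sub>R (v' - v)" "(?e v' - ?e v) *\<^sub>R (z + v)"] by simp
  also have "\<dots> \<le> exp b * norm (v' - v) + exp b * \<kappa> * norm (v' - v) * K"
    using \<kappa> e K K0 by (intro add_mono mult_mono) auto
  finally show ?thesis by (simp add: algebra_simps)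
qed

text \<open>In logarithmic form the claim is \<open>\<kappa> * (s - r) < ln (s / r)\<close>. It
  follows from \<open>1 - r / s \<le> ln (s / r)\<close> because
  \<open>\<kappa> < 1 / s\<close>.\<close>

lemma damped_identity_strict_mono:
  fixes \<kappa> r s :: real
  assumes "0 \<le> \<kappa>" "0 < r" "r < s" "\<kappa> * s < 1"
  shows "r * exp (- (\<kappa> * r)) < s * exp (- (\<kappa> * s))"
proof -
  have "\<kappa> * (s - r) < (1 / s) * (s - r)"
    using assms by (intro mult_strict_right_mono) (auto simp: field_simps)
  also have "\<dots> = 1 - r / s" using assms by (simp add: field_simps)
  also have "\<dots> \<le> ln (s / r)"
    using ln_le_minus_one[of "r / s"] assms by (simp add: ln_div)
  finally have "\<kappa> * (s - r) < ln (s / r)" .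
  then have "exp (\<kappa> * (s - r)) < s / r"
    using assms by (metis divide_pos_pos exp_ln exp_less_mono order.strict_trans)
  then show ?thesis
    using assms by (simp add: field_simps exp_diff exp_minus right_diff_distrib)
qed

text \<open>With \<open>v = t y - z\<close> the equation for \<open>v\<close> reduces to a scalar equation for \<open>t\<close>,
  solved by the intermediate value theorem.\<close>

lemma damped_shift_locally_onto:
  fixes v0 :: "'a::euclidean_space"
  assumes \<kappa>: "0 \<le> \<kappa>" "\<kappa> * norm v0 < 1" and v0: "v0 \<noteq> 0" and \<delta>: "0 < \<delta>"
  obtains \<eta> y0 where "0 < \<eta>"
    "\<And>z y. norm z < \<eta> \<Longrightarrow> y \<in> ball y0 \<eta> \<Longrightarrow> \<exists>v\<in>ball v0 \<delta>. exp (b - \<kappa> * norm v) *\<^sub>R (z + v) = y"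
proof -
  \<comment> \<open>\<open>y0\<close> is the image of \<open>v0\<close> when \<open>z = 0\<close>,
    and \<open>t0\<close> is the inverse of its damping factor. A zero \<open>t\<close> of
    \<open>\<phi>\<close> at \<open>(z, y)\<close> says that \<open>v = t *\<^sub>R y - z\<close>
    has damping factor \<open>1 / t\<close>, so that \<open>v\<close> is mapped to \<open>y\<close>;
    at \<open>(0, y0)\<close> this zero is \<open>t0\<close>.\<close>
  define y0 where "y0 = exp (b - \<kappa> * norm v0) *\<^sub>R v0"
  define t0 where "t0 = exp (\<kappa> * norm v0 - b)"
  define \<phi> where "\<phi> = (\<lambda>t p. t - exp (\<kappa> * norm (t *\<^sub>R snd p - fst p :: 'a) - b))"
  have t0: "t0 > 0" "t0 *\<^sub>R y0 = v0" by (auto simp: t0_def y0_def exp_diff)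
  have y0: "y0 \<noteq> 0" using v0 by (simp add: y0_def)
  then have y0': "norm y0 > 0" by simp
  have \<kappa>0: "\<kappa> * (t0 * norm y0) < 1" using \<kappa>(2) t0 by (metis abs_of_pos norm_scaleR)
  have fix0: "t0 * exp (- (\<kappa> * (t0 * norm y0))) = exp (- b)"
  proof -
    have "norm v0 = t0 * norm y0" using t0 by (metis abs_of_pos norm_scaleR)
    then show ?thesis by (simp add: t0_def exp_diff exp_minus field_simps)
  qed
  \<comment> \<open>The interval around \<open>t0\<close> must stay positive and in the range where
    the damped identity increases; moving \<open>t\<close> within it may displace \<open>v\<close>
    by at most half of \<open>\<delta>\<close>.\<close>
  obtain \<tau> where \<tau>: "\<tau> > 0" "\<tau> < t0" "\<kappa> * ((t0 + \<tau>) * norm y0) < 1" "\<tau> * norm y0 < \<delta> / 2"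
  proof -
    have "((\<lambda>\<tau>. \<kappa> * ((t0 + \<tau>) * norm y0)) \<longlongrightarrow> \<kappa> * ((t0 + 0) * norm y0)) (at_right 0)"
      by (intro tendsto_intros)
    then have 1: "\<forall>\<^sub>F \<tau> in at_right 0. \<kappa> * ((t0 + \<tau>) * norm y0) < 1"
      using \<kappa>0 by (intro order_tendstoD(2)) auto
    have "((\<lambda>\<tau>. \<tau> * norm y0) \<longlongrightarrow> 0 * norm y0) (at_right 0)"
      by (intro tendsto_intros)
    then have 2: "\<forall>\<^sub>F \<tau> in at_right 0. \<tau> * norm y0 < \<delta> / 2"
      using \<delta> by (intro order_tendstoD(2)) auto
    have 3: "\<forall>\<^sub>F \<tau> in at_right 0. \<tau> > 0 \<and> \<tau> < t0"
      using t0 eventually_at_right_real[of 0 t0] by (auto elim: eventually_mono)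
    have "\<forall>\<^sub>F \<tau> in at_right (0::real). \<tau> > 0 \<and> \<tau> < t0 \<and> \<kappa> * ((t0 + \<tau>) * norm y0) < 1 \<and> \<tau> * norm y0 < \<delta> / 2"
      using 1 2 3 by eventually_elim auto
    then obtain \<tau> where "\<tau> > 0 \<and> \<tau> < t0 \<and> \<kappa> * ((t0 + \<tau>) * norm y0) < 1 \<and> \<tau> * norm y0 < \<delta> / 2"
      using eventually_happens[of _ "at_right (0::real)"] by fastforce
    then show ?thesis using that by blast
  qed
  \<comment> \<open>Up to a positive factor, \<open>\<phi>\<close> compares the damped identity at
    \<open>t\<close> with its value at \<open>t0\<close>, so monotonicity gives opposite strict
    signs at the two endpoints.\<close>
  have sgn_eq: "\<phi> t (0, y0) = exp (\<kappa> * (t * norm y0)) * (t * exp (- (\<kappa> * (t * norm y0))) - exp (- b))"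
    if "t > 0" for t
    using that by (simp add: \<phi>_def algebra_simps exp_diff exp_minus divide_inverse flip: exp_add)
  have neg: "\<phi> (t0 - \<tau>) (0, y0) < 0"
  proof -
    have "((t0 - \<tau>) * norm y0) * exp (- (\<kappa> * ((t0 - \<tau>) * norm y0)))
        < (t0 * norm y0) * exp (- (\<kappa> * (t0 * norm y0)))"
      using \<tau> y0' \<kappa>0 \<kappa>(1) by (intro damped_identity_strict_mono) auto
    then have "norm y0 * ((t0 - \<tau>) * exp (- (\<kappa> * ((t0 - \<tau>) * norm y0)))) < norm y0 * exp (- b)"
      by (simp add: fix0[symmetric] mult_ac)
    then have "(t0 - \<tau>) * exp (- (\<kappa> * ((t0 - \<tau>) * norm y0))) < exp (- b)"
      using y0' mult_less_cancel_left_pos by blast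
    then show ?thesis using sgn_eq[of "t0 - \<tau>"] \<tau> by (simp add: mult_pos_neg)
  qed
  have pos: "\<phi> (t0 + \<tau>) (0, y0) > 0"
  proof -
    have "(t0 * norm y0) * exp (- (\<kappa> * (t0 * norm y0)))
        < ((t0 + \<tau>) * norm y0) * exp (- (\<kappa> * ((t0 + \<tau>) * norm y0)))"
      using \<tau> y0' t0 \<kappa>(1) by (intro damped_identity_strict_mono) auto
    then have "norm y0 * exp (- b) < norm y0 * ((t0 + \<tau>) * exp (- (\<kappa> * ((t0 + \<tau>) * norm y0))))"
      by (simp add: fix0[symmetric] mult_ac)
    then have "exp (- b) < (t0 + \<tau>) * exp (- (\<kappa> * ((t0 + \<tau>) * norm y0)))"
      using y0' mult_less_cancel_left_pos by blast
    then show ?thesis using sgn_eq[of "t0 + \<tau>"] \<tau> t0 by simp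
  qed
  have cont: "continuous_on UNIV (\<phi> t)" for t
    unfolding \<phi>_def by (intro continuous_intros)
  \<comment> \<open>The strict endpoint signs are open conditions on \<open>(z, y)\<close>, so one
    \<open>\<eta>\<close> serves all nearby states and targets.\<close>
  define W where "W = {p. \<phi> (t0 - \<tau>) p < 0} \<inter> {p. 0 < \<phi> (t0 + \<tau>) p}"
  have "open W" unfolding W_def
    by (intro open_Int open_Collect_less continuous_on_const cont)
  moreover have "(0, y0) \<in> W" using neg pos by (simp add: W_def)
  ultimately obtain W1 W2 where W12: "open W1" "open W2" "(0, y0) \<in> W1 \<times> W2" "W1 \<times> W2 \<subseteq> W"
    by (rule open_prod_elim)
  from W12 obtain \<eta>1 where \<eta>1: "\<eta>1 > 0" "ball 0 \<eta>1 \<subseteq> W1" by (auto simp: open_contains_ball)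
  from W12 obtain \<eta>2 where \<eta>2: "\<eta>2 > 0" "ball y0 \<eta>2 \<subseteq> W2" by (auto simp: open_contains_ball)
  \<comment> \<open>The last bound keeps the displacement of \<open>v\<close> caused by
    \<open>y - y0\<close> and \<open>z\<close> within the other half of
    \<open>\<delta>\<close>.\<close>
  define \<eta> where "\<eta> = min (min \<eta>1 \<eta>2) (\<delta> / (2 * (t0 + \<tau> + 1)))"
  have "\<eta> > 0" using \<eta>1 \<eta>2 \<delta> t0 \<tau> by (simp add: \<eta>_def)
  moreover have "\<exists>v\<in>ball v0 \<delta>. exp (b - \<kappa> * norm v) *\<^sub>R (z + v) = y"
    if z: "norm z < \<eta>" and y: "y \<in> ball y0 \<eta>" for z y
  proof -
    have "(z, y) \<in> W" using z y \<eta>1 \<eta>2 W12(4) by (auto simp: \<eta>_def subset_iff)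
    then have sg: "\<phi> (t0 - \<tau>) (z, y) \<le> 0" "0 \<le> \<phi> (t0 + \<tau>) (z, y)" by (auto simp: W_def)
    have "continuous_on {t0 - \<tau>..t0 + \<tau>} (\<lambda>t. \<phi> t (z, y))"
      unfolding \<phi>_def by (intro continuous_intros)
    then obtain t where t: "t0 - \<tau> \<le> t" "t \<le> t0 + \<tau>" "\<phi> t (z, y) = 0"
      using IVT'[of "\<lambda>t. \<phi> t (z, y)" "t0 - \<tau>" 0 "t0 + \<tau>", OF sg] \<tau> by auto
    define v where "v = t *\<^sub>R y - z"
    have tv: "t = exp (\<kappa> * norm v - b)" using t(3) by (simp add: \<phi>_def v_def)
    have "exp (b - \<kappa> * norm v) *\<^sub>R (z + v) = (exp (b - \<kappa> * norm v) * t) *\<^sub>R y"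
      by (simp add: v_def)
    also have "\<dots> = y" by (simp add: tv flip: exp_add)
    finally have eq: "exp (b - \<kappa> * norm v) *\<^sub>R (z + v) = y" .
    have "v - v0 = (t - t0) *\<^sub>R y0 + t *\<^sub>R (y - y0) - z"
      using t0(2) by (simp add: v_def algebra_simps)
    then have "norm (v - v0) \<le> \<bar>t - t0\<bar> * norm y0 + \<bar>t\<bar> * norm (y - y0) + norm z"
      by (metis (no_types, lifting) add_right_mono norm_scaleR norm_triangle_ineq norm_triangle_ineq4 order_trans)
    also have "\<dots> \<le> \<tau> * norm y0 + (t0 + \<tau>) * \<eta> + \<eta>"
      using t \<tau> z y by (intro add_mono mult_mono) (auto simp: dist_norm norm_minus_commute)
    also have "\<dots> = \<tau> * norm y0 + (t0 + \<tau> + 1) * \<eta>" by (simp add: algebra_simps)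
    also have "\<dots> \<le> \<tau> * norm y0 + (t0 + \<tau> + 1) * (\<delta> / (2 * (t0 + \<tau> + 1)))"
      using t0 \<tau> by (intro add_left_mono mult_left_mono) (auto simp: \<eta>_def)
    also have "\<dots> = \<tau> * norm y0 + \<delta> / 2" using t0 \<tau> by (simp add: field_simps)
    also have "\<dots> < \<delta>" using \<tau>(4) by simp
    finally have "v \<in> ball v0 \<delta>" by (simp add: dist_norm norm_minus_commute)
    with eq show ?thesis by blast
  qed
  ultimately show ?thesis by (rule that)
qed

section \<open>Ranking and the normalized step\<close>

lemma ranks_ranking: "ranks g lam (ranking g lam)"
  unfolding ranking_def by (rule theI'[OF ranks_ex1])

lemma ranking_eqI: "ranks g lam s \<Longrightarrow> ranking g lam = s"
  using ranks_ranking ranks_unique by blast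

lemma ranking_in: "i \<in> {1..lam} \<Longrightarrow> ranking g lam i \<in> {1..lam}"
  using ranks_ranking[of g lam] permutes_in_image unfolding ranks_def by fastforce

text \<open>Strict inequalities and ties are both determined by \<open>\<le>\<close>, so
  \<open>ranks\<close> sees only the preorder of the values. Through this lemma scaling invariance
  acts on the ranking.\<close>

lemma ranking_cong:
  assumes "\<And>i j. i \<in> {1..lam} \<Longrightarrow> j \<in> {1..lam} \<Longrightarrow> g i \<le> g j \<longleftrightarrow> h i \<le> h j"
  shows "ranking g lam = ranking h lam"
proof (rule ranking_eqI)
  let ?s = "ranking h lam"
  have lt: "g i < g j \<longleftrightarrow> h i < h j" "g i = g j \<longleftrightarrow> h i = h j"
    if "i \<in> {1..lam}" "j \<in> {1..lam}" for i j
    using assms[of i j] assms[of j i] that by auto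
  show "ranks g lam ?s"
    unfolding ranks_def
  proof (intro conjI allI impI)
    show "?s permutes {1..lam}" using ranks_ranking[of h lam] by (simp add: ranks_def)
    fix i j assume "1 \<le> i \<and> i < j \<and> j \<le> lam"
    moreover from this have "?s i \<in> {1..lam}" "?s j \<in> {1..lam}"
      using ranking_in[of i lam h] ranking_in[of j lam h] by auto
    ultimately show "g (?s i) < g (?s j) \<or> (g (?s i) = g (?s j) \<and> ?s i < ?s j)"
      using ranks_ranking[of h lam] lt[of "?s i" "?s j"] unfolding ranks_def by auto
  qed
qed

lemma ranking_strict_mono:
  assumes "strict_mono_on {1..lam} g"
  shows "ranking g lam = id"
  using assms by (intro ranking_eqI) (auto simp: ranks_def permutes_id strict_mono_on_def)

text \<open>The ranking takes finitely many values, so the selected vector is a finite sum over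
  permutations \<open>s\<close> of \<open>X (s i)\<close> restricted to the measurable event that
  \<open>s\<close> is the ranking.\<close>

lemma borel_measurable_ranking_select:
  fixes X :: "nat \<Rightarrow> 'a \<Rightarrow> 'b::{second_countable_topology, real_normed_vector}"
  assumes g: "\<And>j. j \<in> {1..lam} \<Longrightarrow> g j \<in> borel_measurable N"
    and X: "\<And>j. j \<in> {1..lam} \<Longrightarrow> X j \<in> borel_measurable N"
    and i: "i \<in> {1..lam}"
  shows "(\<lambda>p. X (ranking (\<lambda>j. g j p) lam i) p) \<in> borel_measurable N"
proof -
  let ?S = "{s. s permutes {1..lam}}"
  have fin: "finite ?S" by (simp add: finite_permutations)
  have eq: "X (ranking (\<lambda>j. g j p) lam i) p
      = (\<Sum>s\<in>?S. if ranks (\<lambda>j. g j p) lam s then X (s i) p else 0)" for p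
  proof -
    have "(\<Sum>s\<in>?S. if ranks (\<lambda>j. g j p) lam s then X (s i) p else 0)
        = (\<Sum>s\<in>?S. if s = ranking (\<lambda>j. g j p) lam then X (s i) p else 0)"
      using ranks_ranking ranking_eqI by (intro sum.cong refl if_cong) metis
    then show ?thesis using fin ranks_ranking[of "\<lambda>j. g j p" lam] by (simp add: sum.delta' ranks_def)
  qed
  have pred: "Measurable.pred N (\<lambda>p. ranks (\<lambda>j. g j p) lam s)" if s: "s \<in> ?S" for s
  proof -
    have in_s: "s j \<in> {1..lam}" if "j \<in> {1..lam}" for j
      using s that permutes_in_image by fastforce
    then have [measurable]: "g (s j) \<in> borel_measurable N" if "j \<in> {1..lam}" for j
      using that g by blast
    have bounded: "(\<forall>i j. 1 \<le> i \<and> i < j \<and> j \<le> lam \<longrightarrow> Q i j) \<longleftrightarrow>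
        (\<forall>i\<in>{1..lam}. \<forall>j\<in>{1..lam}. i < j \<longrightarrow> Q i j)" for Q :: "nat \<Rightarrow> nat \<Rightarrow> bool"
      by force
    have "ranks (\<lambda>j. g j p) lam s \<longleftrightarrow> (\<forall>i\<in>{1..lam}. \<forall>j\<in>{1..lam}. i < j \<longrightarrow>
        g (s i) p < g (s j) p \<or> (g (s i) p = g (s j) p \<and> s i < s j))" for p
      using s unfolding ranks_def bounded by simp
    then show ?thesis by simp measurable
  qed
  have "(\<lambda>p. if ranks (\<lambda>j. g j p) lam s then X (s i) p else 0) \<in> borel_measurable N" if s: "s \<in> ?S" for s
  proof -
    have "s i \<in> {1..lam}" using s i permutes_in_image by fastforce
    then show ?thesis using X pred[OF s] by (intro measurable_If) (auto simp: pred_def)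
  qed
  then show ?thesis unfolding eq by (intro borel_measurable_sum) auto
qed

section \<open>The normalized update as a map of state and directions\<close>

text \<open>This is the coefficient of \<open>norm v\<close> in the exponent of
  \<open>es_factor\<close>. The type argument carries the dimension, which enters only through the
  expected norm.\<close>

definition damping :: "'d::finite itself \<Rightarrow> nat \<Rightarrow> (nat \<Rightarrow> real) \<Rightarrow> real \<Rightarrow> real" where
  "damping _ mu w ds =
     1 / ds * (sqrt (mu_eff mu w) / (\<integral>x. norm (x :: real ^ 'd) \<partial>std_normal_vec))"

lemma damping_nonneg: "ds > 0 \<Longrightarrow> 0 \<le> damping TYPE('d::finite) mu w ds"
  unfolding damping_def mu_eff_def
  by (intro mult_nonneg_nonneg divide_nonneg_nonneg real_sqrt_ge_zero sum_nonneg
      Bochner_Integration.integral_nonneg) auto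

lemma es_factor_eq:
  fixes v :: "real ^ 'd"
  shows "es_factor mu w ds v = exp (damping TYPE('d) mu w ds * norm v - 1 / ds)"
  by (simp add: es_factor_def damping_def right_diff_distrib)

text \<open>The random map behind \<open>normalized_kernel\<close>, isolated so that the kernel and
  the trajectory can be written with the same function.\<close>

definition normalized_step ::
  "(real ^ 'd \<Rightarrow> real) \<Rightarrow> nat \<Rightarrow> nat \<Rightarrow> (nat \<Rightarrow> real) \<Rightarrow> real \<Rightarrow> real ^ 'd
     \<Rightarrow> real ^ 'd \<Rightarrow> (nat \<Rightarrow> real ^ 'd) \<Rightarrow> real ^ 'd"
where
  "normalized_step f lam mu w ds xs z u = normalized xs (es_step f lam mu w ds (xs + z, 1) u)"

lemma normalized_step_eq:
  fixes f :: "real ^ 'd \<Rightarrow> real"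
  shows "normalized_step f lam mu w ds xs z u =
    (let v = es_move f lam mu w (xs + z) 1 u
     in exp (1 / ds - damping TYPE('d) mu w ds * norm v) *\<^sub>R (z + v))"
  by (simp add: normalized_step_def normalized_def es_step_def Let_def es_factor_eq exp_diff)

text \<open>Candidates from \<open>(m, \<sigma>)\<close> are, relative to \<open>xs\<close>, the
  candidates from \<open>(xs + z, 1)\<close> scaled by \<open>\<sigma>\<close>. Scaling invariance
  gives equal rankings, hence equal moves, and \<open>\<sigma>\<close> cancels in the quotient. This
  makes the normalized sequence autonomous.\<close>

lemma normalized_es_step:
  assumes f: "scaling_invariant f xs" and \<sigma>: "\<sigma> > 0"
  shows "normalized xs (es_step f lam mu w ds (m, \<sigma>) u)
    = normalized_step f lam mu w ds xs (normalized xs (m, \<sigma>)) u"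
proof -
  define z where "z = normalized xs (m, \<sigma>)"
  have m: "m = xs + \<sigma> *\<^sub>R z" using \<sigma> by (simp add: z_def normalized_def)
  have "ranking (\<lambda>j. f (m + \<sigma> *\<^sub>R u j)) lam = ranking (\<lambda>j. f (xs + z + u j)) lam"
  proof (rule ranking_cong)
    fix i j
    show "f (m + \<sigma> *\<^sub>R u i) \<le> f (m + \<sigma> *\<^sub>R u j) \<longleftrightarrow> f (xs + z + u i) \<le> f (xs + z + u j)"
      using f[unfolded scaling_invariant_def, rule_format, OF \<sigma>, of "z + u i" "z + u j"]
      by (simp add: m algebra_simps)
  qed
  then have "es_move f lam mu w m \<sigma> u = es_move f lam mu w (xs + z) 1 u"
    by (simp add: es_move_def)
  then show ?thesis
    using \<sigma> by (simp add: z_def[symmetric] normalized_step_def es_step_def)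
      (simp add: normalized_def m scaleR_add_right)
qed

text \<open>The ranking maps selected indices into \<open>{1..lam}\<close>, so the directions may be
  replaced by their restriction, a point of the product space.\<close>

lemma es_move_cong:
  assumes "mu \<le> lam" "\<And>i. i \<in> {1..lam} \<Longrightarrow> u i = u' i"
  shows "es_move f lam mu w m \<sigma> u = es_move f lam mu w m \<sigma> u'"
proof -
  have "ranking (\<lambda>j. f (m + \<sigma> *\<^sub>R u j)) lam = ranking (\<lambda>j. f (m + \<sigma> *\<^sub>R u' j)) lam"
    using assms(2) by (intro ranking_cong) auto
  moreover have "u (ranking g lam i) = u' (ranking g lam i)" if "i \<in> {1..mu}" for i g
    using that assms by (intro assms(2) ranking_in) auto
  ultimately show ?thesis by (simp add: es_move_def)
qed

lemma normalized_step_cong: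
  assumes "mu \<le> lam" "\<And>i. i \<in> {1..lam} \<Longrightarrow> u i = u' i"
  shows "normalized_step f lam mu w ds xs z u = normalized_step f lam mu w ds xs z u'"
  using es_move_cong[OF assms] by (simp add: normalized_step_eq Let_def)

lemma measurable_normalized_step:
  fixes f :: "real ^ 'd \<Rightarrow> real"
  assumes f: "continuous_on UNIV f" and mu: "mu \<le> lam"
  shows "(\<lambda>(z, u). normalized_step f lam mu w ds xs z u)
    \<in> borel \<Otimes>\<^sub>M PiM {1..lam} (\<lambda>_. borel) \<rightarrow>\<^sub>M borel"
proof -
  let ?N = "borel \<Otimes>\<^sub>M PiM {1..lam} (\<lambda>_. borel) :: ((real ^ 'd) \<times> (nat \<Rightarrow> real ^ 'd)) measure"
  have [measurable]: "f \<in> borel_measurable borel"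
    using f by (rule borel_measurable_continuous_onI)
  have [measurable]: "(\<lambda>p. es_move f lam mu w (xs + fst p) 1 (snd p)) \<in> borel_measurable ?N"
    unfolding es_move_def scaleR_one
  proof (intro borel_measurable_sum borel_measurable_scaleR borel_measurable_const)
    fix i assume i: "i \<in> {1..mu}"
    show "(\<lambda>p. snd p (ranking (\<lambda>j. f (xs + fst p + snd p j)) lam i)) \<in> borel_measurable ?N"
    proof (rule borel_measurable_ranking_select[where X = "\<lambda>j p. snd p j" and g = "\<lambda>j p. f (xs + fst p + snd p j)"])
      fix j assume [measurable]: "j \<in> {1..lam}"
      show "(\<lambda>p. snd p j) \<in> borel_measurable ?N" by measurable
      show "(\<lambda>p. f (xs + fst p + snd p j)) \<in> borel_measurable ?N" by measurable
    qed (use i mu in auto)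
  qed
  show ?thesis
    unfolding normalized_step_eq Let_def case_prod_beta by measurable
qed

section \<open>The normal law compared with Lebesgue measure\<close>

lemma sets_std_normal_vec [measurable_cong]: "sets std_normal_vec = sets borel"
  by (simp add: std_normal_vec_def)

text \<open>The density is continuous and positive, so it attains a positive minimum on a nonempty
  compact ball; for negative \<open>K\<close> only the empty set has to be considered.\<close>

lemma std_normal_vec_ge_lborel:
  obtains p where "p > 0"
    "\<And>A. A \<in> sets borel \<Longrightarrow> A \<subseteq> cball 0 K \<Longrightarrow>
       ennreal p * emeasure lborel A \<le> emeasure (std_normal_vec :: (real ^ 'd) measure) A"
proof (cases "K \<ge> 0")
  case True
  let ?\<phi> = "\<lambda>x :: real ^ 'd. \<Prod>i\<in>UNIV. std_normal_density (x $ i)"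
  have "continuous_on (cball 0 K) ?\<phi>"
    unfolding std_normal_density_def by (intro continuous_intros) auto
  then obtain x0 where x0: "\<And>x. x \<in> cball 0 K \<Longrightarrow> ?\<phi> x0 \<le> ?\<phi> x"
    using continuous_attains_inf[OF compact_cball, of 0 K ?\<phi>] True by (metis cball_eq_empty not_less)
  have "?\<phi> x0 > 0" by (intro prod_pos) (simp add: normal_density_pos)
  moreover have "ennreal (?\<phi> x0) * emeasure lborel A \<le> emeasure std_normal_vec A"
    if A: "A \<in> sets borel" "A \<subseteq> cball 0 K" for A :: "(real ^ 'd) set"
  proof -
    have "ennreal (?\<phi> x0) * emeasure lborel A = (\<integral>\<^sup>+x. ennreal (?\<phi> x0) * indicator A x \<partial>lborel)"
      using A by (simp add: nn_integral_cmult_indicator)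
    also have "\<dots> \<le> (\<integral>\<^sup>+x. ennreal (?\<phi> x) * indicator A x \<partial>lborel)"
      using A x0 by (intro nn_integral_mono) (auto split: split_indicator intro!: ennreal_leI)
    also have "\<dots> = emeasure std_normal_vec A"
      unfolding std_normal_vec_def using A by (subst emeasure_density) auto
    finally show ?thesis .
  qed
  ultimately show ?thesis by (rule that)
next
  case False
  then show ?thesis by (intro that[of 1]) auto
qed

lemma emeasure_std_normal_vec_ball_pos:
  fixes x :: "real ^ 'd"
  assumes "r > 0"
  shows "emeasure std_normal_vec (ball x r) > 0"
proof -
  obtain p where p: "p > 0" "\<And>A. A \<in> sets borel \<Longrightarrow> A \<subseteq> cball 0 (norm x + r) \<Longrightarrow>
       ennreal p * emeasure lborel A \<le> emeasure (std_normal_vec :: (real ^ 'd) measure) A"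
    using std_normal_vec_ge_lborel by blast
  have sub: "ball x r \<subseteq> cball 0 (norm x + r)"
  proof
    fix y assume "y \<in> ball x r"
    then show "y \<in> cball 0 (norm x + r)"
      using norm_triangle_ineq2[of y x] by (simp add: dist_norm norm_minus_commute)
  qed
  have "0 < ennreal p * emeasure lborel (ball x r)"
    using p(1) assms by (simp add: ennreal_zero_less_mult_iff emeasure_ball content_ball_pos unit_ball_vol_pos)
  also have "\<dots> \<le> emeasure std_normal_vec (ball x r)" using p(2) sub by simp
  finally show ?thesis .
qed

section \<open>Lower bounds for the normalized kernel\<close>

text \<open>A ball is not contained in a null level set, so \<open>f\<close> takes two values on it.
  Connectedness gives every value in between; equally spaced levels are picked, and continuity keeps
  nearby values within half the spacing of their level, so their order is preserved.\<close>

lemma ordered_points: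
  fixes f :: "'a::euclidean_space \<Rightarrow> real"
  assumes f: "continuous_on UNIV f" "negligible_level_sets f" and \<delta>: "\<delta> > 0"
  obtains r and p :: "nat \<Rightarrow> 'a" where "r > 0" "\<forall>i\<in>{1..n}. p i \<in> ball x \<delta>"
    "\<forall>y. (\<forall>i\<in>{1..n}. y i \<in> ball (p i) r) \<longrightarrow> strict_mono_on {1..n} (\<lambda>i. f (y i))"
proof -
  have "\<exists>a\<in>ball x \<delta>. f a \<noteq> f x"
  proof (rule ccontr)
    assume "\<not> ?thesis"
    then have "ball x \<delta> \<subseteq> {y. f y = f x}" by auto
    moreover have "negligible {y. f y = f x}"
      using f(2) by (simp add: negligible_level_sets_def negligible_iff_null_sets)
    ultimately have "negligible (ball x \<delta>)" by (rule negligible_subset[rotated])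
    then show False using \<delta> open_not_negligible[of "ball x \<delta>"] by auto
  qed
  then obtain a b where ab: "a \<in> ball x \<delta>" "b \<in> ball x \<delta>" "f a < f b"
    using \<delta> by (metis centre_in_ball linorder_neqE_linordered_idom)
  \<comment> \<open>The denominator \<open>n + 1\<close> keeps all \<open>n\<close> levels inside
    \<open>{f a..f b}\<close> and also covers \<open>n = 0\<close>.\<close>
  define gap where "gap = (f b - f a) / (real n + 1)"
  define t where "t i = f a + gap * real i" for i
  have gap: "gap > 0" using ab by (simp add: gap_def)
  have "connected (f ` ball x \<delta>)"
    using f(1) by (intro connected_continuous_image connected_ball) (auto intro: continuous_on_subset)
  then have icc: "{f a..f b} \<subseteq> f ` ball x \<delta>"
    using ab by (intro connected_contains_Icc) auto
  have "t i \<in> {f a..f b}" if "i \<in> {1..n}" for i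
  proof -
    have "gap * real i \<le> gap * (real n + 1)" using gap that by (intro mult_left_mono) auto
    also have "\<dots> = f b - f a" by (simp add: gap_def)
    finally show ?thesis using gap by (simp add: t_def)
  qed
  then have "\<forall>i\<in>{1..n}. \<exists>p\<in>ball x \<delta>. f p = t i" using icc by (metis imageE subsetD)
  then obtain p where p: "\<And>i. i \<in> {1..n} \<Longrightarrow> p i \<in> ball x \<delta>" "\<And>i. i \<in> {1..n} \<Longrightarrow> f (p i) = t i"
    by metis
  have "\<exists>r>0. \<forall>y\<in>ball (p i) r. \<bar>f y - f (p i)\<bar> < gap / 2" for i
  proof -
    have "isCont f (p i)" using f(1) by (simp add: continuous_on_eq_continuous_at)
    then obtain r where "r > 0" "\<forall>y. dist y (p i) < r \<longrightarrow> dist (f y) (f (p i)) < gap / 2"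
      using gap unfolding continuous_at_eps_delta by (metis half_gt_zero)
    then show ?thesis by (intro exI[of _ r]) (auto simp: dist_commute dist_real_def)
  qed
  then obtain \<rho> where \<rho>: "\<And>i. \<rho> i > 0" "\<And>i y. y \<in> ball (p i) (\<rho> i) \<Longrightarrow> \<bar>f y - f (p i)\<bar> < gap / 2"
    by metis
  define r where "r = Min (insert 1 (\<rho> ` {1..n}))"
  have r: "r > 0" using \<rho>(1) by (auto simp: r_def)
  have r_le: "r \<le> \<rho> i" if "i \<in> {1..n}" for i
    unfolding r_def using that by (intro Min_le) auto
  have mono: "strict_mono_on {1..n} (\<lambda>i. f (y i))" if y: "\<forall>i\<in>{1..n}. y i \<in> ball (p i) r" for y
  proof (rule strict_mono_onI)
    have close: "\<bar>f (y i) - t i\<bar> < gap / 2" if "i \<in> {1..n}" for i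
      using y[rule_format, OF that] r_le[OF that] \<rho>(2)[of "y i" i] p(2)[OF that] by auto
    fix i j assume ij: "i \<in> {1..n}" "j \<in> {1..n}" "i < j"
    have "gap * (real i + 1) \<le> gap * real j" using ij gap by (intro mult_left_mono) auto
    then have "t i + gap \<le> t j" by (simp add: t_def algebra_simps)
    then show "f (y i) < f (y j)" using close[OF ij(1)] close[OF ij(2)] by linarith
  qed
  show ?thesis
  proof (rule that[OF r])
    show "\<forall>i\<in>{1..n}. p i \<in> ball x \<delta>" using p(1) by blast
    show "\<forall>y. (\<forall>i\<in>{1..n}. y i \<in> ball (p i) r) \<longrightarrow> strict_mono_on {1..n} (\<lambda>i. f (y i))"
      by (intro allI impI mono)
  qed
qed

text \<open>A finite subcover leaves finitely many positive constants, whose minimum works;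
  inserting \<open>1\<close> covers an empty subcover.\<close>

lemma compact_uniform_lower_bound:
  fixes h :: "'a::metric_space \<Rightarrow> ennreal"
  assumes C: "compact C"
    and loc: "\<And>z. z \<in> C \<Longrightarrow> \<exists>r>0. \<exists>\<epsilon>>0. \<forall>x\<in>ball z r. \<epsilon> \<le> h x"
  shows "\<exists>\<epsilon>>0. \<forall>x\<in>C. \<epsilon> \<le> h x"
proof -
  obtain r \<epsilon> where r: "\<And>z. z \<in> C \<Longrightarrow> r z > 0" "\<And>z. z \<in> C \<Longrightarrow> \<epsilon> z > 0"
    "\<And>z x. z \<in> C \<Longrightarrow> x \<in> ball z (r z) \<Longrightarrow> \<epsilon> z \<le> h x"
    using loc by metis
  obtain D where D: "D \<subseteq> C" "finite D" "C \<subseteq> (\<Union>z\<in>D. ball z (r z))"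
    by (rule compactE_image[OF C, of C "\<lambda>z. ball z (r z)"]) (use r(1) in auto)
  show ?thesis
  proof (intro exI conjI ballI)
    show "Min (insert 1 (\<epsilon> ` D)) > 0" using D r(2) by auto
    fix x assume "x \<in> C"
    then obtain z where z: "z \<in> D" "x \<in> ball z (r z)" using D(3) by auto
    then have "Min (insert 1 (\<epsilon> ` D)) \<le> \<epsilon> z" using D(2) by (intro Min_le) auto
    also have "\<epsilon> z \<le> h x" using r(3) z D(1) by blast
    finally show "Min (insert 1 (\<epsilon> ` D)) \<le> h x" .
  qed
qed

text \<open>These are the assumptions on the kernel alone, apart from any trajectory. That the
  normal law has total mass one is assumed here and supplied later by the law of a sampled
  direction.\<close>

locale es_kernel =
  fixes f :: "real ^ 'd \<Rightarrow> real" and xs :: "real ^ 'd" and lam mu :: nat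
    and w :: "nat \<Rightarrow> real" and ds :: real and \<kappa> :: real
  assumes f_continuous: "continuous_on UNIV f"
    and f_levels: "negligible_level_sets f"
    and mu: "mu \<in> {1..lam}"
    and w_pos: "\<And>i. i \<in> {1..mu} \<Longrightarrow> w i > 0"
    and w_sum: "(\<Sum>i=1..mu. w i) = 1"
    and ds: "ds > 0"
    and \<kappa>_eq: "\<kappa> = damping TYPE('d) mu w ds"
    and prob_normal: "prob_space (std_normal_vec :: (real ^ 'd) measure)"
begin

abbreviation "\<gamma> \<equiv> std_normal_vec :: (real ^ 'd) measure"
abbreviation "step \<equiv> normalized_step f lam mu w ds xs"
abbreviation "P \<equiv> normalized_kernel f lam mu w ds xs"

lemma \<kappa>: "\<kappa> \<ge> 0" unfolding \<kappa>_eq using ds by (rule damping_nonneg)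

lemma sets_PiM_normal [measurable_cong]: "sets (PiM I (\<lambda>_. \<gamma>)) = sets (PiM I (\<lambda>_. borel))"
  by (intro sets_PiM_cong refl sets_std_normal_vec)

lemma space_PiM_normal: "space (PiM I (\<lambda>_. \<gamma>)) = PiE I (\<lambda>_. UNIV)"
  by (simp add: space_PiM std_normal_vec_def)

lemma step_measurable:
  "(\<lambda>(z, u). step z u) \<in> borel \<Otimes>\<^sub>M PiM {1..lam} (\<lambda>_. \<gamma>) \<rightarrow>\<^sub>M borel"
proof -
  have "(\<lambda>(z, u). step z u) \<in> borel \<Otimes>\<^sub>M PiM {1..lam} (\<lambda>_. borel) \<rightarrow>\<^sub>M borel"
    using mu by (intro measurable_normalized_step f_continuous) auto
  moreover have "sets (borel \<Otimes>\<^sub>M PiM {1..lam} (\<lambda>_. \<gamma>)) = sets (borel \<Otimes>\<^sub>M PiM {1..lam} (\<lambda>_. borel))"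
    by (intro sets_pair_measure_cong refl sets_PiM_normal)
  ultimately show ?thesis using measurable_cong_sets[OF _ refl] by blast
qed

lemma step_measurable1 [measurable]: "step z \<in> PiM {1..lam} (\<lambda>_. \<gamma>) \<rightarrow>\<^sub>M borel"
  using measurable_compose[OF measurable_Pair1' step_measurable, of z] by simp

lemma prob_PiM_normal: "prob_space (PiM I (\<lambda>_. \<gamma>))"
  by (intro prob_space_PiM prob_normal)

lemma product_sigma_finite_normal: "product_sigma_finite (\<lambda>_ :: nat. \<gamma>)"
  unfolding product_sigma_finite_def using prob_space_imp_sigma_finite[OF prob_normal] by blast

lemma P_eq: "P z = distr (PiM {1..lam} (\<lambda>_. \<gamma>)) borel (step z)"
  by (simp add: normalized_kernel_def normalized_step_def[abs_def])

lemma emeasure_P: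
  "A \<in> sets borel \<Longrightarrow> emeasure (P z) A = (\<integral>\<^sup>+u. indicator A (step z u) \<partial>PiM {1..lam} (\<lambda>_. \<gamma>))"
  unfolding P_eq using nn_integral_distr[OF step_measurable1, of "indicator A" z] by simp

lemma markov_kernel_P: "markov_kernel P"
  unfolding markov_kernel_def
proof (rule measurable_prob_algebraI)
  show "prob_space (P x)" for x
    unfolding P_eq using prob_PiM_normal step_measurable1 by (rule prob_space.prob_space_distr)
  have "(\<lambda>_. PiM {1..lam} (\<lambda>_. \<gamma>)) \<in> borel \<rightarrow>\<^sub>M subprob_algebra (PiM {1..lam} (\<lambda>_. \<gamma>))"
    using prob_PiM_normal[of "{1..lam}"]
    by (intro measurable_const) (simp add: space_subprob_algebra prob_space_imp_subprob_space)
  then have "(\<lambda>z. distr (PiM {1..lam} (\<lambda>_. \<gamma>)) borel (step z)) \<in> borel \<rightarrow>\<^sub>M subprob_algebra borel"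
    by (intro measurable_distr2[OF step_measurable])
  then show "P \<in> borel \<rightarrow>\<^sub>M subprob_algebra borel"
    by (simp add: P_eq[abs_def])
qed

lemma weighted_sum_in_convex:
  assumes "convex S" "\<And>i. i \<in> {1..mu} \<Longrightarrow> v i \<in> S"
  shows "(\<Sum>i=1..mu. w i *\<^sub>R v i) \<in> S"
  using assms w_pos w_sum by (intro convex_sum) (auto intro: less_imp_le)

lemma step_ordered:
  assumes "strict_mono_on {1..lam} (\<lambda>j. f (xs + z + u j))"
  shows "step z u = (let v = \<Sum>i=1..mu. w i *\<^sub>R u i in exp (1 / ds - \<kappa> * norm v) *\<^sub>R (z + v))"
  using ranking_strict_mono[OF assms] by (simp add: normalized_step_eq es_move_def \<kappa>_eq)

text \<open>Directions close to suitable centers are already sorted by \<open>f\<close>, hence the ranking drops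
  out of the update.\<close>

lemma ordered_directions:
  assumes \<delta>: "\<delta> > 0"
  obtains r and v :: "nat \<Rightarrow> real ^ 'd" where "0 < r" "r \<le> \<delta>"
    "\<forall>i\<in>{1..lam}. v i \<in> ball v0 \<delta>"
    "\<forall>z\<in>ball z0 r. \<forall>u. (\<forall>i\<in>{1..lam}. u i \<in> ball (v i) r) \<longrightarrow>
       strict_mono_on {1..lam} (\<lambda>j. f (xs + z + u j))"
proof -
  obtain r p where r: "r > 0" and p: "\<forall>i\<in>{1..lam}. p i \<in> ball (xs + z0 + v0) \<delta>"
    and mono: "\<forall>y. (\<forall>i\<in>{1..lam}. y i \<in> ball (p i) r) \<longrightarrow> strict_mono_on {1..lam} (\<lambda>i. f (y i))"
    by (rule ordered_points[OF f_continuous f_levels \<delta>, where n = lam and x = "xs + z0 + v0"])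
  \<comment> \<open>The points \<open>p i\<close> are candidate positions; the directions leading
    there from the state \<open>z0\<close> are obtained by translation. Halving the radius then
    leaves room for moving both state and direction.\<close>
  define v where "v i = p i - xs - z0" for i
  show ?thesis
  proof (rule that[of "min (r / 2) \<delta>" v])
    show "\<forall>z\<in>ball z0 (min (r / 2) \<delta>). \<forall>u. (\<forall>i\<in>{1..lam}. u i \<in> ball (v i) (min (r / 2) \<delta>)) \<longrightarrow>
       strict_mono_on {1..lam} (\<lambda>j. f (xs + z + u j))"
    proof (intro ballI allI impI mono[rule_format])
      fix z u i
      assume z: "z \<in> ball z0 (min (r / 2) \<delta>)"
        and u: "\<forall>i\<in>{1..lam}. u i \<in> ball (v i) (min (r / 2) \<delta>)" and i: "i \<in> {1..lam}"
      have "dist (p i) (xs + z + u i) = norm ((z0 - z) + (v i - u i))"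
        by (simp add: dist_norm v_def algebra_simps)
      also have "\<dots> \<le> norm (z0 - z) + norm (v i - u i)" by (rule norm_triangle_ineq)
      also have "\<dots> < r" using z u[rule_format, OF i] by (simp add: dist_norm)
      finally show "xs + z + u i \<in> ball (p i) r" by simp
    qed
  next
    show "\<forall>i\<in>{1..lam}. v i \<in> ball v0 \<delta>"
      using p by (simp add: v_def dist_norm algebra_simps)
  qed (use r \<delta> in auto)
qed

text \<open>Sorted directions near \<open>- z0\<close> make every \<open>z + u i\<close> small. The
  weights sum to one, so \<open>z + V\<close> is a convex combination of these small vectors, and
  the step-size change enlarges it by at most \<open>exp (1 / ds)\<close>.\<close>

lemma reaches_origin_locally:
  assumes \<eta>: "\<eta> > 0"
  shows "\<exists>r>0. \<exists>\<epsilon>>0. \<forall>z\<in>ball z0 r. \<epsilon> \<le> emeasure (P z) (ball 0 \<eta>)"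
proof -
  \<comment> \<open>The three errors \<open>z - z0\<close>, \<open>u i - v i\<close> and
    \<open>v i + z0\<close> are each below \<open>\<delta>\<close>, and the exponential offsets the
    largest possible factor.\<close>
  define \<delta> where "\<delta> = \<eta> * exp (- (1 / ds)) / 3"
  have \<delta>: "\<delta> > 0" using \<eta> by (simp add: \<delta>_def)
  obtain r v where r: "0 < r" "r \<le> \<delta>" and v: "\<forall>i\<in>{1..lam}. v i \<in> ball (- z0) \<delta>"
    and ord: "\<forall>z\<in>ball z0 r. \<forall>u. (\<forall>i\<in>{1..lam}. u i \<in> ball (v i) r) \<longrightarrow>
       strict_mono_on {1..lam} (\<lambda>j. f (xs + z + u j))"
    by (rule ordered_directions[OF \<delta>, where ?v0.0 = "- z0" and ?z0.0 = z0])
  let ?E = "PiE {1..lam} (\<lambda>i. ball (v i) r)"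
  \<comment> \<open>The probability of the favourable directions, which does not depend on
    \<open>z\<close>.\<close>
  define \<epsilon> where "\<epsilon> = (\<Prod>i\<in>{1..lam}. emeasure \<gamma> (ball (v i) r))"
  have \<epsilon>: "\<epsilon> = emeasure (PiM {1..lam} (\<lambda>_. \<gamma>)) ?E"
    unfolding \<epsilon>_def
    by (subst product_sigma_finite.emeasure_PiM[OF product_sigma_finite_normal])
      (auto simp: sets_std_normal_vec)
  have "emeasure \<gamma> (ball (v i) r) \<noteq> 0" for i
    using emeasure_std_normal_vec_ball_pos[OF r(1), of "v i"] by auto
  then have "\<epsilon> > 0" by (simp add: \<epsilon>_def zero_less_iff_neq_zero)
  moreover have "\<epsilon> \<le> emeasure (P z) (ball 0 \<eta>)" if z: "z \<in> ball z0 r" for z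
  proof -
    have "step z u \<in> ball 0 \<eta>" if "u \<in> ?E" for u
    proof -
      have u: "u i \<in> ball (v i) r" if "i \<in> {1..lam}" for i using \<open>u \<in> ?E\<close> that by auto
      define V where "V = (\<Sum>i=1..mu. w i *\<^sub>R u i)"
      have "z + u i \<in> ball 0 (3 * \<delta>)" if "i \<in> {1..mu}" for i
      proof -
        have i: "i \<in> {1..lam}" using that mu by auto
        have "norm (z + u i) = norm ((z - z0) + ((u i - v i) + (v i - (- z0))))" by simp
        also have "\<dots> \<le> norm (z - z0) + norm ((u i - v i) + (v i - (- z0)))"
          by (rule norm_triangle_ineq)
        also have "\<dots> \<le> norm (z - z0) + (norm (u i - v i) + norm (v i - (- z0)))"
          by (intro add_left_mono norm_triangle_ineq)
        also have "\<dots> < \<delta> + (\<delta> + \<delta>)"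
        proof (intro add_strict_mono)
          show "norm (z - z0) < \<delta>" using z r(2) by (simp add: dist_norm norm_minus_commute)
          show "norm (u i - v i) < \<delta>" using u[OF i] r(2) by (simp add: dist_norm norm_minus_commute)
          show "norm (v i - (- z0)) < \<delta>" using v[rule_format, OF i] by (metis dist_commute dist_norm mem_ball)
        qed
        finally show ?thesis by simp
      qed
      then have "(\<Sum>i=1..mu. w i *\<^sub>R (z + u i)) \<in> ball 0 (3 * \<delta>)"
        by (intro weighted_sum_in_convex) auto
      also have "(\<Sum>i=1..mu. w i *\<^sub>R (z + u i)) = z + V"
        using w_sum by (simp add: scaleR_add_right sum.distrib V_def flip: scaleR_left.sum)
      finally have "norm (z + V) < 3 * \<delta>" by simp
      moreover have "exp (1 / ds - \<kappa> * norm V) \<le> exp (1 / ds)" using \<kappa> by simp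
      ultimately have "exp (1 / ds - \<kappa> * norm V) * norm (z + V) < exp (1 / ds) * (3 * \<delta>)"
        by (intro mult_le_less_imp_less) auto
      also have "\<dots> = \<eta>" by (simp add: \<delta>_def exp_minus)
      finally have lt: "exp (1 / ds - \<kappa> * norm V) * norm (z + V) < \<eta>" .
      have "step z u = exp (1 / ds - \<kappa> * norm V) *\<^sub>R (z + V)"
        using step_ordered[OF ord[rule_format, OF z u]] unfolding Let_def V_def .
      then show ?thesis using lt by simp
    qed
    then have "\<epsilon> \<le> emeasure (PiM {1..lam} (\<lambda>_. \<gamma>)) (step z -` ball 0 \<eta> \<inter> space (PiM {1..lam} (\<lambda>_. \<gamma>)))"
      unfolding \<epsilon> by (intro emeasure_mono measurable_sets[OF step_measurable1]) (auto simp: space_PiM_normal)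
    then show ?thesis unfolding P_eq by (subst emeasure_distr[OF step_measurable1]) simp_all
  qed
  ultimately show ?thesis using r(1) by blast
qed

lemma reaches_origin:
  assumes "\<eta> > 0" "compact C"
  shows "\<exists>\<epsilon>>0. \<forall>z\<in>C. \<epsilon> \<le> emeasure (P z) (ball 0 \<eta>)"
  by (rule compact_uniform_lower_bound[OF assms(2)]) (rule reaches_origin_locally[OF assms(1)])

text \<open>Given the directions \<open>u 2, \<dots>, u lam\<close>, the next state is a Lipschitz function of \<open>u 1\<close>
  alone that attains every point \<open>y\<close> near \<open>y0\<close>, so a ball around \<open>y\<close> has a preimage containing
  a ball of comparable radius. Only the volume of that preimage enters the bound, not its center,
  hence the center need not depend measurably on the other directions.\<close>

lemma minorized_near_origin:
  obtains \<eta> \<rho> y0 c where "\<eta> > 0" "\<rho> > 0" "c > 0"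
    "\<forall>z\<in>ball 0 \<eta>. \<forall>A\<in>sets borel. A \<subseteq> ball y0 \<rho> \<longrightarrow> c * emeasure lborel A \<le> emeasure (P z) A"
proof -
  have mu1: "1 \<in> {1..mu}" "{1..mu} = insert 1 {2..mu}" "{1..lam} = insert 1 {2..lam}"
    using mu by auto
  have w1: "0 < w 1" using w_pos mu1(1) by blast
  have w_split: "w 1 + (\<Sum>i=2..mu. w i) = 1" using w_sum unfolding mu1(2) by simp
  have w_rest: "0 \<le> (\<Sum>i=2..mu. w i)" using w_pos by (intro sum_nonneg) (auto intro: less_imp_le)
  \<comment> \<open>With this length, every \<open>V0\<close> within \<open>norm e / 2\<close> of
    \<open>e\<close> is nonzero and satisfies \<open>\<kappa> * norm V0 < 1\<close>, as required for
    local surjectivity of the damped shift.\<close>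
  obtain e :: "real ^ 'd" where e: "norm e = 1 / (2 * (\<kappa> + 1))"
    using vector_choose_size[of "1 / (2 * (\<kappa> + 1))"] \<kappa> by auto
  define \<delta> where "\<delta> = norm e / 2"
  have \<delta>: "\<delta> > 0" using e \<kappa> by (simp add: \<delta>_def)
  obtain r v where r: "0 < r" "r \<le> \<delta>" and v: "\<forall>i\<in>{1..lam}. v i \<in> ball e \<delta>"
    and ord: "\<forall>z\<in>ball 0 r. \<forall>u. (\<forall>i\<in>{1..lam}. u i \<in> ball (v i) r) \<longrightarrow>
       strict_mono_on {1..lam} (\<lambda>j. f (xs + z + u j))"
    by (rule ordered_directions[OF \<delta>, where ?v0.0 = e and ?z0.0 = 0])
  define V0 where "V0 = (\<Sum>i=1..mu. w i *\<^sub>R v i)"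
  define R where "R u = (\<Sum>i=2..mu. w i *\<^sub>R u i)" for u :: "nat \<Rightarrow> real ^ 'd"
  have V0_split: "V0 = w 1 *\<^sub>R v 1 + R v" unfolding V0_def R_def mu1(2) by simp
  have "V0 \<in> ball e \<delta>" unfolding V0_def
    using v mu by (intro weighted_sum_in_convex) auto
  then have "norm (V0 - e) < norm e / 2" by (simp add: \<delta>_def dist_norm norm_minus_commute)
  then have "norm V0 < 3 / 2 * norm e" "norm V0 > 0"
    using norm_triangle_ineq2[of V0 e] norm_triangle_ineq3[of V0 e] by auto
  moreover have "\<kappa> * (3 / 2 * norm e) < 1" unfolding e using \<kappa> by (simp add: field_simps)
  ultimately have V0: "\<kappa> * norm V0 < 1" "V0 \<noteq> 0"
    using \<kappa> mult_left_mono[of "norm V0" "3 / 2 * norm e" \<kappa>] by auto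
  \<comment> \<open>Errors of size \<open>s\<close> in the target sum and in the other directions
    add up to \<open>2 * s\<close>; dividing by \<open>w 1\<close> turns this into
    \<open>r / 4\<close> for the first direction.\<close>
  define s where "s = w 1 * r / 8"
  have s: "s > 0" using w1 r by (simp add: s_def)
  obtain \<eta>1 y0 where \<eta>1: "0 < \<eta>1"
    and onto: "\<And>z y. norm z < \<eta>1 \<Longrightarrow> y \<in> ball y0 \<eta>1 \<Longrightarrow>
      \<exists>v\<in>ball V0 s. exp (1 / ds - \<kappa> * norm v) *\<^sub>R (z + v) = y"
    by (rule damped_shift_locally_onto[OF \<kappa> V0 s, where b = "1 / ds"]) blast
  define \<eta> where "\<eta> = min \<eta>1 r"
  have \<eta>: "\<eta> > 0" using \<eta>1 r by (simp add: \<eta>_def)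
  \<comment> \<open>\<open>K\<close> bounds \<open>norm (z + V)\<close> for all admissible states
    and sums, and \<open>L\<close> is the resulting Lipschitz constant of the damped shift.\<close>
  define K where "K = \<eta> + (norm V0 + s)"
  have K: "K > 0" using \<eta> s by (simp add: K_def add_pos_nonneg)
  define L where "L = exp (1 / ds) * (1 + \<kappa> * K)"
  have L: "L > 0" using \<kappa> K by (simp add: L_def add_pos_nonneg)
  obtain p where p: "p > 0" "\<And>A :: (real ^ 'd) set. A \<in> sets borel \<Longrightarrow> A \<subseteq> cball 0 (norm (v 1) + r) \<Longrightarrow>
       ennreal p * emeasure lborel A \<le> emeasure \<gamma> A"
    using std_normal_vec_ge_lborel by blast
  define E where "E = PiE {2..lam} (\<lambda>i. ball (v i) s)"
  define \<epsilon>E where "\<epsilon>E = emeasure (PiM {2..lam} (\<lambda>_. \<gamma>)) E"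
  have \<epsilon>E_eq: "\<epsilon>E = (\<Prod>i\<in>{2..lam}. emeasure \<gamma> (ball (v i) s))"
    unfolding \<epsilon>E_def E_def
    by (subst product_sigma_finite.emeasure_PiM[OF product_sigma_finite_normal])
      (auto simp: sets_std_normal_vec)
  have "emeasure \<gamma> (ball (v i) s) \<noteq> 0" for i
    using emeasure_std_normal_vec_ball_pos[OF s, of "v i"] by auto
  then have \<epsilon>E: "\<epsilon>E > 0" by (simp add: \<epsilon>E_eq zero_less_iff_neq_zero)
  have E_sets: "E \<in> sets (PiM {2..lam} (\<lambda>_. \<gamma>))"
    unfolding E_def by (intro sets_PiM_I_finite) (auto simp: sets_std_normal_vec)
  \<comment> \<open>The probability of the event for the other directions, times the density bound,
    times the volume ratio of balls of radii \<open>\<epsilon> / L\<close> and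
    \<open>\<epsilon>\<close>.\<close>
  define c where "c = \<epsilon>E * (ennreal p * ennreal (1 / L ^ CARD('d)))"
  have c: "c > 0" using \<epsilon>E p(1) L by (simp add: c_def ennreal_zero_less_mult_iff)

  have hit: "\<exists>a. ball a (\<epsilon> / L) \<subseteq> cball 0 (norm (v 1) + r) \<and>
      (\<forall>y'\<in>ball a (\<epsilon> / L). step z (u(1 := y')) \<in> ball y \<epsilon>)"
    if z: "z \<in> ball 0 \<eta>" and y: "y \<in> ball y0 \<eta>1" and \<epsilon>: "0 < \<epsilon>" "\<epsilon> < L * r / 4" and u: "u \<in> E" for z y \<epsilon> u
  proof -
    have ui: "norm (u i - v i) < s" if "i \<in> {2..lam}" for i
      using u that by (auto simp: E_def dist_norm norm_minus_commute dest: PiE_mem)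
    obtain V where V: "V \<in> ball V0 s" "exp (1 / ds - \<kappa> * norm V) *\<^sub>R (z + V) = y"
      using onto[of z y] z y by (auto simp: \<eta>_def)
    \<comment> \<open>The first direction that completes the weighted sum to exactly
      \<open>V\<close>, hence sends \<open>z\<close> to \<open>y\<close>.\<close>
    define a where "a = (1 / w 1) *\<^sub>R (V - R u)"
    have wa: "w 1 *\<^sub>R a = V - R u" using w1 by (simp add: a_def)
    have "norm (R u - R v) \<le> (\<Sum>i=2..mu. norm (w i *\<^sub>R (u i - v i)))"
      unfolding R_def sum_subtractf[symmetric] scaleR_diff_right[symmetric] by (rule norm_sum)
    also have "\<dots> \<le> (\<Sum>i=2..mu. w i * s)"
    proof (rule sum_mono)
      fix i assume "i \<in> {2..mu}"
      then have "i \<in> {1..mu}" "i \<in> {2..lam}" using mu by auto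
      then show "norm (w i *\<^sub>R (u i - v i)) \<le> w i * s"
        using w_pos[of i] ui[of i] by (auto intro!: mult_left_mono)
    qed
    also have "\<dots> = (1 - w 1) * s" using w_split by (simp flip: sum_distrib_right)
    also have "\<dots> \<le> s" using w1 s by (simp add: left_diff_distrib)
    finally have Ru: "norm (R u - R v) \<le> s" .
    have "w 1 *\<^sub>R (a - v 1) = (V - V0) - (R u - R v)"
      using wa V0_split by (simp add: algebra_simps)
    then have "w 1 * norm (a - v 1) = norm ((V - V0) - (R u - R v))"
      using w1 by (metis abs_of_pos norm_scaleR)
    also have "\<dots> \<le> norm (V - V0) + norm (R u - R v)" by (rule norm_triangle_ineq4)
    also have "\<dots> < s + s" using V(1) Ru by (intro add_less_le_mono) (auto simp: dist_norm norm_minus_commute)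
    also have "\<dots> = w 1 * (r / 4)" by (simp add: s_def)
    finally have a: "norm (a - v 1) < r / 4" using w1 by simp
    \<comment> \<open>The whole ball around \<open>a\<close> thus stays in the region around
      \<open>v 1\<close> where the ranking is the identity.\<close>
    have \<epsilon>L: "\<epsilon> / L < r / 4" using \<epsilon>(2) L by (simp add: field_simps)
    have near: "y' \<in> ball (v 1) r" if "y' \<in> ball a (\<epsilon> / L)" for y'
    proof -
      have "dist (v 1) y' \<le> dist (v 1) a + dist a y'" by (rule dist_triangle)
      also have "\<dots> < r / 4 + r / 4"
      proof (rule add_strict_mono)
        show "dist (v 1) a < r / 4" using a by (metis dist_commute dist_norm)
        show "dist a y' < r / 4" using that \<epsilon>L by (meson mem_ball order.strict_trans)
      qed
      finally show ?thesis using r(1) by simp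
    qed
    have sub: "ball a (\<epsilon> / L) \<subseteq> cball 0 (norm (v 1) + r)"
    proof
      fix y' assume "y' \<in> ball a (\<epsilon> / L)"
      then show "y' \<in> cball 0 (norm (v 1) + r)"
        using near[of y'] norm_triangle_ineq2[of y' "v 1"] by (simp add: dist_norm norm_minus_commute)
    qed
    have "step z (u(1 := y')) \<in> ball y \<epsilon>" if y': "y' \<in> ball a (\<epsilon> / L)" for y'
    proof -
      have "\<forall>i\<in>{1..lam}. (u(1 := y')) i \<in> ball (v i) r"
      proof
        fix i assume i: "i \<in> {1..lam}"
        have "w 1 \<le> 1" using w_split w_rest by linarith
        then have "w 1 * r \<le> 1 * r" using r(1) by (intro mult_right_mono) auto
        then have "s \<le> r" using r(1) unfolding s_def by linarith
        then show "(u(1 := y')) i \<in> ball (v i) r"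
          using near[OF y'] ui[of i] i by (cases "i = 1") (auto simp: dist_norm norm_minus_commute)
      qed
      moreover have "z \<in> ball 0 r" using z by (simp add: \<eta>_def)
      ultimately have st: "step z (u(1 := y')) =
          (let v = \<Sum>i=1..mu. w i *\<^sub>R (u(1 := y')) i in exp (1 / ds - \<kappa> * norm v) *\<^sub>R (z + v))"
        using ord by (intro step_ordered) blast
      define V' where "V' = w 1 *\<^sub>R y' + R u"
      have sum_eq: "(\<Sum>i=1..mu. w i *\<^sub>R (u(1 := y')) i) = V'"
        unfolding mu1(2) V'_def R_def by (simp add: sum.insert)
      have st': "step z (u(1 := y')) = exp (1 / ds - \<kappa> * norm V') *\<^sub>R (z + V')"
        unfolding st Let_def sum_eq ..
      have "norm (z + V) \<le> norm z + (norm V0 + norm (V - V0))"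
        using norm_triangle_ineq[of z V] norm_triangle_sub[of V V0] by linarith
      also have "\<dots> \<le> K"
        unfolding K_def using z V(1) by (intro add_mono) (auto simp: dist_norm norm_minus_commute)
      finally have zV: "norm (z + V) \<le> K" .
      have "norm (step z (u(1 := y')) - y) \<le> L * norm (V' - V)"
        unfolding st' V(2)[symmetric] L_def by (rule damped_shift_lipschitz[OF \<kappa> zV])
      also have "V' - V = w 1 *\<^sub>R (y' - a)" using wa by (simp add: V'_def scaleR_diff_right)
      also have "norm (w 1 *\<^sub>R (y' - a)) = w 1 * norm (y' - a)" using w1 by simp
      \<comment> \<open>Since \<open>w 1 \<le> 1\<close>, the constant \<open>L\<close> also works
        for the dependence on the first direction alone.\<close>
      also have "L * (w 1 * norm (y' - a)) \<le> L * (1 * norm (y' - a))"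
        using w_split w_rest L by (intro mult_left_mono mult_right_mono) auto
      also have "\<dots> < L * (\<epsilon> / L)"
        using y' L by (intro mult_strict_left_mono) (auto simp: dist_norm norm_minus_commute)
      also have "\<dots> = \<epsilon>" using L by simp
      finally show ?thesis by (metis dist_commute dist_norm mem_ball)
    qed
    with sub show ?thesis by blast
  qed

  have balls: "c * emeasure lborel (ball y \<epsilon>) \<le> emeasure (P z) (ball y \<epsilon>)"
    if z: "z \<in> ball 0 \<eta>" and y: "y \<in> ball y0 \<eta>1" and \<epsilon>: "0 < \<epsilon>" "\<epsilon> < L * r / 4" for z y and \<epsilon> :: real
  proof -
    define q where "q = ennreal p * (ennreal (1 / L ^ CARD('d)) * emeasure lborel (ball y \<epsilon>))"
    have vol: "emeasure lborel (ball a (\<epsilon> / L)) = ennreal (1 / L ^ CARD('d)) * emeasure lborel (ball y \<epsilon>)"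
      for a :: "real ^ 'd"
      using \<epsilon>(1) L by (simp add: emeasure_ball power_divide unit_ball_vol_nonneg flip: ennreal_mult)
    \<comment> \<open>With the other directions frozen, the bound \<open>q\<close> is the same for
      every \<open>u\<close> in \<open>E\<close>; integrating it over \<open>u\<close> by Tonelli
      gives the bound for the kernel.\<close>
    have inner: "q * indicator E u \<le> (\<integral>\<^sup>+y'. indicator (ball y \<epsilon>) (step z (u(1 := y'))) \<partial>\<gamma>)" for u
    proof (cases "u \<in> E")
      case True
      obtain a where a: "ball a (\<epsilon> / L) \<subseteq> cball 0 (norm (v 1) + r)"
          "\<forall>y'\<in>ball a (\<epsilon> / L). step z (u(1 := y')) \<in> ball y \<epsilon>"
        using hit[OF z y \<epsilon> True] by blast
      have "q \<le> emeasure \<gamma> (ball a (\<epsilon> / L))"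
        unfolding q_def vol[of a, symmetric] using a(1) by (intro p(2)) auto
      also have "\<dots> = (\<integral>\<^sup>+y'. indicator (ball a (\<epsilon> / L)) y' \<partial>\<gamma>)"
        by (simp add: sets_std_normal_vec)
      also have "\<dots> \<le> (\<integral>\<^sup>+y'. indicator (ball y \<epsilon>) (step z (u(1 := y'))) \<partial>\<gamma>)"
        using a(2) by (intro nn_integral_mono) (auto split: split_indicator)
      finally show ?thesis using True by simp
    qed simp
    have "c * emeasure lborel (ball y \<epsilon>) = q * \<epsilon>E"
      by (simp add: c_def q_def mult_ac)
    also have "\<dots> = (\<integral>\<^sup>+u. q * indicator E u \<partial>PiM {2..lam} (\<lambda>_. \<gamma>))"
      using E_sets by (simp add: \<epsilon>E_def nn_integral_cmult_indicator)
    also have "\<dots> \<le> (\<integral>\<^sup>+u. (\<integral>\<^sup>+y'. indicator (ball y \<epsilon>) (step z (u(1 := y'))) \<partial>\<gamma>) \<partial>PiM {2..lam} (\<lambda>_. \<gamma>))"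
      by (intro nn_integral_mono inner)
    also have "\<dots> = (\<integral>\<^sup>+u. indicator (ball y \<epsilon>) (step z u) \<partial>PiM {1..lam} (\<lambda>_. \<gamma>))"
    proof -
      have "(\<lambda>u. indicator (ball y \<epsilon>) (step z u) :: ennreal) \<in> borel_measurable (PiM (insert 1 {2..lam}) (\<lambda>_. \<gamma>))"
        using measurable_compose[OF step_measurable1[of z] borel_measurable_indicator[of "ball y \<epsilon>" borel]]
        unfolding mu1(3) by simp
      then show ?thesis
        unfolding mu1(3)
        by (subst product_sigma_finite.product_nn_integral_insert[OF product_sigma_finite_normal]) auto
    qed
    also have "\<dots> = emeasure (P z) (ball y \<epsilon>)" by (simp add: emeasure_P)
    finally show ?thesis .
  qed

  show ?thesis
  proof (rule that[OF \<eta> \<eta>1 c], intro ballI impI)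
    fix z :: "real ^ 'd" and A :: "(real ^ 'd) set"
    assume z: "z \<in> ball 0 \<eta>" and A: "A \<in> sets borel" "A \<subseteq> ball y0 \<eta>1"
    show "c * emeasure lborel A \<le> emeasure (P z) A"
    proof (rule emeasure_lborel_le_of_balls[where B = "ball y0 \<eta>1"])
      show "sets (P z) = sets borel" by (rule sets_markov_kernel[OF markov_kernel_P])
      show "finite_measure (P z)"
        using prob_space_markov_kernel[OF markov_kernel_P] by (rule prob_space.finite_measure)
      show "0 < L * r / 4" using L r by simp
      show "c * emeasure lborel (ball y \<epsilon>) \<le> emeasure (P z) (ball y \<epsilon>)"
        if "y \<in> ball y0 \<eta>1" "0 < \<epsilon>" "\<epsilon> < L * r / 4" for y \<epsilon>
        using that by (rule balls[OF z])
    qed (rule A)+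
  qed
qed

text \<open>One transition reaches the ball around the origin and the next one spreads over the
  target ball. Lingering near the origin for one extra transition yields the bound at the
  consecutive time.\<close>

lemma minorized: "\<exists>\<nu>. minorized_kernel P \<nu> 2"
proof -
  obtain \<eta> \<rho> y0 c where \<eta>: "\<eta> > 0" and \<rho>: "\<rho> > 0" and c: "c > 0"
    and near: "\<forall>z\<in>ball 0 \<eta>. \<forall>A\<in>sets borel. A \<subseteq> ball y0 \<rho> \<longrightarrow> c * emeasure lborel A \<le> emeasure (P z) A"
    by (rule minorized_near_origin)
  note P = markov_kernel_P
  define \<nu> where "\<nu> = density lborel (indicator (ball y0 \<rho>))"
  have \<nu>: "emeasure \<nu> A = emeasure lborel (ball y0 \<rho> \<inter> A)" if "A \<in> sets borel" for A
  proof -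
    have "emeasure \<nu> A = (\<integral>\<^sup>+x. indicator (ball y0 \<rho>) x * indicator A x \<partial>lborel)"
      unfolding \<nu>_def using that by (intro emeasure_density borel_measurable_indicator) auto
    also have "\<dots> = (\<integral>\<^sup>+x. indicator (ball y0 \<rho> \<inter> A) x \<partial>lborel)"
      by (intro nn_integral_cong) (auto split: split_indicator)
    also have "\<dots> = emeasure lborel (ball y0 \<rho> \<inter> A)"
      using that by (intro nn_integral_indicator) auto
    finally show ?thesis .
  qed
  have one: "c * emeasure \<nu> A \<le> emeasure (kernel_pow P (Suc 0) z) A"
    if z: "z \<in> ball 0 \<eta>" and A: "A \<in> sets borel" for z A
  proof -
    have "c * emeasure \<nu> A \<le> emeasure (P z) (ball y0 \<rho> \<inter> A)"
      using near z A by (simp add: \<nu>)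
    also have "\<dots> \<le> emeasure (P z) A"
      using A sets_markov_kernel[OF P, of z] by (intro emeasure_mono) auto
    finally show ?thesis using emeasure_kernel_pow_1[OF P A] by simp
  qed
  have "\<exists>\<epsilon>>0. \<forall>x\<in>C. \<forall>A\<in>sets borel.
      \<epsilon> * emeasure \<nu> A \<le> emeasure (kernel_pow P 2 x) A \<and>
      \<epsilon> * emeasure \<nu> A \<le> emeasure (kernel_pow P (Suc 2) x) A" if C: "compact C" for C
  proof -
    \<comment> \<open>The ball is added so that the same \<open>\<epsilon>\<close> also bounds the
      probability of returning to it from within, as the three-step bound needs.\<close>
    have "compact (C \<union> cball 0 \<eta>)" using C by (intro compact_Un compact_cball)
    then obtain \<epsilon> where \<epsilon>: "\<epsilon> > 0" "\<forall>z\<in>C \<union> cball 0 \<eta>. \<epsilon> \<le> emeasure (P z) (ball 0 \<eta>)"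
      using reaches_origin[OF \<eta>] by blast
    have two: "\<epsilon> * (c * emeasure \<nu> A) \<le> emeasure (kernel_pow P 2 x) A"
      if "x \<in> C \<union> cball 0 \<eta>" "A \<in> sets borel" for x A
      unfolding numeral_2_eq_2
    proof (rule kernel_pow_Suc_ge[OF P, of "ball 0 \<eta>"])
      show "\<epsilon> \<le> emeasure (P x) (ball 0 \<eta>)" using \<epsilon>(2) that(1) by blast
      show "c * emeasure \<nu> A \<le> emeasure (kernel_pow P (Suc 0) y) A" if "y \<in> ball 0 \<eta>" for y
        using one that \<open>A \<in> sets borel\<close> by blast
    qed (use that in auto)
    have three: "\<epsilon> * (\<epsilon> * (c * emeasure \<nu> A)) \<le> emeasure (kernel_pow P (Suc 2) x) A"
      if "x \<in> C" "A \<in> sets borel" for x A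
    proof (rule kernel_pow_Suc_ge[OF P, of "ball 0 \<eta>"])
      show "\<epsilon> \<le> emeasure (P x) (ball 0 \<eta>)" using \<epsilon>(2) that(1) by blast
      show "\<epsilon> * (c * emeasure \<nu> A) \<le> emeasure (kernel_pow P 2 y) A" if "y \<in> ball 0 \<eta>" for y
        using two[of y A] that \<open>A \<in> sets borel\<close> by auto
    qed (use that in auto)
    define \<epsilon>' where "\<epsilon>' = min (\<epsilon> * c) (\<epsilon> * \<epsilon> * c)"
    have "\<epsilon>' > 0" using \<epsilon>(1) c by (simp add: \<epsilon>'_def ennreal_zero_less_mult_iff)
    moreover have "\<epsilon>' * emeasure \<nu> A \<le> emeasure (kernel_pow P 2 x) A" if "x \<in> C" "A \<in> sets borel" for x A
    proof -
      have "\<epsilon>' * emeasure \<nu> A \<le> (\<epsilon> * c) * emeasure \<nu> A"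
        by (rule mult_right_mono) (auto simp: \<epsilon>'_def)
      then show ?thesis using two[of x A] that by (simp add: mult.assoc)
    qed
    moreover have "\<epsilon>' * emeasure \<nu> A \<le> emeasure (kernel_pow P (Suc 2) x) A" if "x \<in> C" "A \<in> sets borel" for x A
    proof -
      have "\<epsilon>' * emeasure \<nu> A \<le> (\<epsilon> * \<epsilon> * c) * emeasure \<nu> A"
        by (rule mult_right_mono) (auto simp: \<epsilon>'_def)
      then show ?thesis using three[of x A] that by (simp add: mult.assoc)
    qed
    ultimately show ?thesis by blast
  qed
  moreover have "emeasure \<nu> UNIV \<noteq> 0"
    using \<rho> content_ball_pos[of \<rho> y0] by (auto simp: \<nu> measure_def)
  moreover have "sets \<nu> = sets borel" by (simp add: \<nu>_def)
  ultimately have "minorized_kernel P \<nu> 2"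
    by (intro minorized_kernel.intro P) auto
  then show ?thesis by blast
qed

end

section \<open>The Markov property\<close>

text \<open>A random iteration driven by fresh noise of law \<open>Q\<close> is Markov: independence
  makes the joint law of past and noise a product, and Fubini integrates the noise out, leaving the
  kernel at the last state.\<close>

lemma homogeneous_markov_chain_iteration:
  fixes z :: "nat \<Rightarrow> 'w \<Rightarrow> 'a::topological_space"
  assumes M: "prob_space M" and P: "markov_kernel P"
    and z: "\<And>k. z k \<in> M \<rightarrow>\<^sub>M borel"
    and V: "\<And>k. V k \<in> M \<rightarrow>\<^sub>M Q" "\<And>k. distr M Q (V k) = Q"
    and g: "(\<lambda>(x, u). g x u) \<in> borel \<Otimes>\<^sub>M Q \<rightarrow>\<^sub>M borel" and P_eq: "\<And>x. P x = distr Q borel (g x)"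
    and step: "\<And>k \<omega>. \<omega> \<in> space M \<Longrightarrow> z (Suc k) \<omega> = g (z k \<omega>) (V k \<omega>)"
    and indep: "\<And>k. prob_space.indep_var M (PiM {..k} (\<lambda>_. borel)) (\<lambda>\<omega>. \<lambda>j\<in>{..k}. z j \<omega>) Q (V k)"
  shows "homogeneous_markov_chain M z P"
  unfolding homogeneous_markov_chain_def
proof (intro conjI allI ballI M P z)
  fix k and A :: "'a set" assume A: "A \<in> sets borel"
  interpret prob_space M by (rule M)
  let ?S = "PiM {..k} (\<lambda>_. borel) :: (nat \<Rightarrow> 'a) measure"
  define past where "past = (\<lambda>\<omega>. \<lambda>j\<in>{..k}. z j \<omega>)"
  let ?F = "vimage_algebra (space M) past ?S"
  have past: "past \<in> M \<rightarrow>\<^sub>M ?S"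
    unfolding past_def by (intro measurable_restrict z)
  have subalg: "subalgebra M ?F"
    by (simp add: subalgebra_def sets_image_in_sets[OF refl past])
  interpret F: finite_measure_subalgebra M ?F
    by unfold_locales (rule subalg)
  interpret Q: prob_space Q
    using prob_space_distr[OF V(1), of 0] V(2) by simp
  interpret D: prob_space "distr M ?S past" by (rule prob_space_distr[OF past])
  interpret DQ: pair_prob_space "distr M ?S past" Q ..
  have joint: "distr M ?S past \<Otimes>\<^sub>M Q = distr M (?S \<Otimes>\<^sub>M Q) (\<lambda>\<omega>. (past \<omega>, V k \<omega>))"
    using indep[of k] V(2)[of k] unfolding indep_var_distribution_eq past_def by simp
  have gk: "(\<lambda>(p, v). g (p k) v) \<in> ?S \<Otimes>\<^sub>M Q \<rightarrow>\<^sub>M borel"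
  proof -
    have "(\<lambda>x. (fst x k, snd x)) \<in> ?S \<Otimes>\<^sub>M Q \<rightarrow>\<^sub>M borel \<Otimes>\<^sub>M Q"
      by (intro measurable_Pair measurable_snd measurable_compose[OF measurable_fst]
          measurable_component_singleton) simp
    from measurable_compose[OF this g] show ?thesis by (simp add: case_prod_beta)
  qed
  have kernel: "(\<lambda>x. measure (P x) A) \<in> borel_measurable borel"
  proof -
    have "P \<in> borel \<rightarrow>\<^sub>M subprob_algebra borel"
      using P by (auto simp: markov_kernel_def intro: measurable_prob_algebraD)
    then show ?thesis by (rule measurable_compose) (rule measurable_measure_subprob_algebra[OF A])
  qed
  show "AE \<omega> in M. real_cond_exp M (vimage_algebra (space M) (\<lambda>\<omega>. \<lambda>j\<in>{..k}. z j \<omega>) ?S)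
      (\<lambda>\<omega>. indicator A (z (Suc k) \<omega>)) \<omega> = measure (P (z k \<omega>)) A"
    unfolding past_def[symmetric]
  \<comment> \<open>It remains to check measurability with respect to the past and equality of
    integrals over past events, which are preimages under \<open>past\<close>.\<close>
  proof (rule F.real_cond_exp_charact)
    show "integrable M (\<lambda>\<omega>. indicator A (z (Suc k) \<omega>) :: real)"
      using A z by (intro integrable_const_bound[where B = 1] measurable_compose[OF z borel_measurable_indicator]) auto
    show "integrable M (\<lambda>\<omega>. measure (P (z k \<omega>)) A)"
      using prob_space.prob_le_1[OF prob_space_markov_kernel[OF P]]
      by (intro integrable_const_bound[where B = 1] measurable_compose[OF z kernel]) auto
    have "past \<in> ?F \<rightarrow>\<^sub>M ?S"
      using past by (intro measurable_vimage_algebra1) (auto dest: measurable_space)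
    from measurable_compose[OF measurable_compose[OF this measurable_component_singleton] kernel, of k]
    show "(\<lambda>\<omega>. measure (P (z k \<omega>)) A) \<in> borel_measurable ?F"
      by (simp add: past_def)
  next
    fix B assume "B \<in> sets ?F"
    then obtain C where C: "C \<in> sets ?S" "B = past -` C \<inter> space M"
      using past by (subst (asm) sets_vimage_algebra2) (auto dest: measurable_space)
    \<comment> \<open>The past event and the next transition written as one function of past and
      noise, to be integrated against the product law.\<close>
    define h :: "(nat \<Rightarrow> 'a) \<times> _ \<Rightarrow> real" where "h = (\<lambda>(p, v). indicator C p * indicator A (g (p k) v))"
    have h: "h \<in> borel_measurable (?S \<Otimes>\<^sub>M Q)"
    proof -
      have "(\<lambda>x. indicator C (fst x) :: real) \<in> borel_measurable (?S \<Otimes>\<^sub>M Q)"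
        by (intro measurable_compose[OF measurable_fst] borel_measurable_indicator C)
      moreover have "(\<lambda>x. indicator A ((\<lambda>(p, v). g (p k) v) x) :: real) \<in> borel_measurable (?S \<Otimes>\<^sub>M Q)"
        by (intro measurable_compose[OF gk] borel_measurable_indicator A)
      ultimately show ?thesis
        unfolding h_def case_prod_beta by (intro borel_measurable_times) auto
    qed
    have hint: "integrable (distr M ?S past \<Otimes>\<^sub>M Q) h"
    proof (intro DQ.integrable_const_bound[where B = 1])
      show "h \<in> borel_measurable (distr M ?S past \<Otimes>\<^sub>M Q)"
        using h measurable_cong_sets[OF sets_pair_measure_cong[OF sets_distr refl] refl] by blast
    qed (auto simp: h_def indicator_def)
    have inner: "(\<integral>v. h (p, v) \<partial>Q) = indicator C p * measure (P (p k)) A" for p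
    proof -
      have gp: "g (p k) \<in> Q \<rightarrow>\<^sub>M borel"
        using measurable_compose[OF measurable_Pair1' g, of "p k"] by simp
      have "(\<integral>v. indicator A (g (p k) v) \<partial>Q) = (\<integral>y. indicator A y \<partial>P (p k) :: real)"
        unfolding P_eq using A by (intro integral_distr[OF gp, symmetric]) simp
      also have "\<dots> = measure (P (p k)) A"
        using A by (simp add: P_eq)
      finally show ?thesis by (simp add: h_def)
    qed
    have "(LINT \<omega>:B|M. indicator A (z (Suc k) \<omega>)) = (\<integral>\<omega>. h (past \<omega>, V k \<omega>) \<partial>M)"
      unfolding set_lebesgue_integral_def using C(2) step
      by (intro Bochner_Integration.integral_cong) (auto simp: h_def past_def indicator_def)
    also have "\<dots> = integral\<^sup>L (distr M ?S past \<Otimes>\<^sub>M Q) h"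
      unfolding joint by (intro integral_distr[symmetric] measurable_Pair past V h)
    also have "\<dots> = (\<integral>p. (\<integral>v. h (p, v) \<partial>Q) \<partial>distr M ?S past)"
      using DQ.integral_fst'[OF hint] by simp
    also have "\<dots> = (\<integral>p. indicator C p * measure (P (p k)) A \<partial>distr M ?S past)"
      by (simp add: inner)
    also have "\<dots> = (\<integral>\<omega>. indicator C (past \<omega>) * measure (P (past \<omega> k)) A \<partial>M)"
      by (intro integral_distr past borel_measurable_times borel_measurable_indicator C
          measurable_compose[OF _ kernel] measurable_component_singleton) simp
    also have "\<dots> = (LINT \<omega>:B|M. measure (P (z k \<omega>)) A)"
      unfolding set_lebesgue_integral_def using C(2)
      by (intro Bochner_Integration.integral_cong) (auto simp: past_def indicator_def)
    finally show "(LINT \<omega>:B|M. indicator A (z (Suc k) \<omega>)) = (LINT \<omega>:B|M. measure (P (z k \<omega>)) A)" .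
  qed
qed

section \<open>The evolution strategy as a random iteration\<close>

lemma measurable_normalized: "normalized xs \<in> borel \<rightarrow>\<^sub>M borel"
  unfolding normalized_def borel_prod[symmetric] case_prod_beta by measurable

context adaptive_es
begin

lemma \<sigma>_pos: "\<omega> \<in> space M \<Longrightarrow> \<sigma> k \<omega> > 0"
proof (induction k)
  case 0
  then show ?case by (rule \<sigma>_init_pos)
next
  case (Suc k)
  then show ?case using update[of \<omega> k] by (simp add: es_step_def es_factor_def)
qed

lemma normalized_update:
  assumes "scaling_invariant f xs" "mu \<le> lam" "\<omega> \<in> space M"
  shows "normalized xs (m (Suc k) \<omega>, \<sigma> (Suc k) \<omega>)
    = normalized_step f lam mu w ds xs (normalized xs (m k \<omega>, \<sigma> k \<omega>)) (\<lambda>i\<in>{1..lam}. U (Suc k) i \<omega>)"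
  unfolding update[OF assms(3)] normalized_es_step[OF assms(1) \<sigma>_pos[OF assms(3)]]
  using assms(2) by (intro normalized_step_cong) auto

lemma normalized_measurable: "(\<lambda>\<omega>. normalized xs (m k \<omega>, \<sigma> k \<omega>)) \<in> M \<rightarrow>\<^sub>M borel"
  using measurable_compose[OF borel_measurable_Pair[OF m_measurable \<sigma>_measurable] measurable_normalized] .

text \<open>No Gaussian integral is computed: the measure is the law of the direction
  \<open>U 1 1\<close>, whose index is valid as \<open>lam \<ge> 1\<close>.\<close>

lemma prob_space_std_normal_vec:
  assumes "lam \<ge> 1"
  shows "prob_space (std_normal_vec :: (real ^ 'd) measure)"
  using prob_space_distr[OF U_measurable[of 1 0]] U_normal[of 1 0] assms by simp

lemma
  assumes "lam \<ge> 1"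
  shows directions_measurable:
      "(\<lambda>\<omega>. \<lambda>i\<in>{1..lam}. U (Suc k) i \<omega>) \<in> M \<rightarrow>\<^sub>M PiM {1..lam} (\<lambda>_. std_normal_vec)"
    and distr_directions:
      "distr M (PiM {1..lam} (\<lambda>_. std_normal_vec)) (\<lambda>\<omega>. \<lambda>i\<in>{1..lam}. U (Suc k) i \<omega>)
        = PiM {1..lam} (\<lambda>_. std_normal_vec)"
proof -
  have sets_eq: "sets (PiM {1..lam} (\<lambda>_. std_normal_vec :: (real ^ 'd) measure)) = sets (PiM {1..lam} (\<lambda>_. borel))"
    by (intro sets_PiM_cong refl sets_std_normal_vec)
  have meas: "(\<lambda>\<omega>. \<lambda>i\<in>{1..lam}. U (Suc k) i \<omega>) \<in> M \<rightarrow>\<^sub>M PiM {1..lam} (\<lambda>_. borel)"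
    by (intro measurable_restrict U_measurable)
  then show "(\<lambda>\<omega>. \<lambda>i\<in>{1..lam}. U (Suc k) i \<omega>) \<in> M \<rightarrow>\<^sub>M PiM {1..lam} (\<lambda>_. std_normal_vec)"
    using measurable_cong_sets[OF refl sets_eq] by blast
  have "distr M (PiM {1..lam} (\<lambda>_. borel)) (\<lambda>\<omega>. \<lambda>i\<in>{1..lam}. U (Suc k) i \<omega>)
      = PiM {1..lam} (\<lambda>i. distr M borel (U (Suc k) i))"
    using U_indep[of k] assms U_measurable
    by (subst (asm) indep_vars_iff_distr_eq_PiM') auto
  also have "\<dots> = PiM {1..lam} (\<lambda>_. std_normal_vec)"
    by (intro PiM_cong refl U_normal)
  finally show "distr M (PiM {1..lam} (\<lambda>_. std_normal_vec)) (\<lambda>\<omega>. \<lambda>i\<in>{1..lam}. U (Suc k) i \<omega>)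
        = PiM {1..lam} (\<lambda>_. std_normal_vec)"
    using distr_cong[OF refl sets_eq refl] by metis
qed

text \<open>The model makes the new directions independent of all earlier states and directions. The
  normalized past is a measurable function of that data, so it generates a smaller sigma-algebra and
  inherits the independence.\<close>

lemma indep_normalized_past:
  assumes "lam \<ge> 1"
  shows "indep_var (PiM {..k} (\<lambda>_. borel)) (\<lambda>\<omega>. \<lambda>j\<in>{..k}. normalized xs (m j \<omega>, \<sigma> j \<omega>))
    (PiM {1..lam} (\<lambda>_. std_normal_vec)) (\<lambda>\<omega>. \<lambda>i\<in>{1..lam}. U (Suc k) i \<omega>)"
proof -
  let ?S = "PiM {..k} (\<lambda>_. borel) :: (nat \<Rightarrow> real ^ 'd) measure"
  let ?Q = "PiM {1..lam} (\<lambda>_. std_normal_vec) :: (nat \<Rightarrow> real ^ 'd) measure"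
  let ?past = "\<lambda>\<omega>. \<lambda>j\<in>{..k}. normalized xs (m j \<omega>, \<sigma> j \<omega>)"
  let ?V = "\<lambda>\<omega>. \<lambda>i\<in>{1..lam}. U (Suc k) i \<omega>"
  define B where "B = (PiM {..k} (\<lambda>_. borel) \<Otimes>\<^sub>M PiM ({1..k} \<times> {1..lam}) (\<lambda>_. borel)
    :: ((nat \<Rightarrow> (real ^ 'd) \<times> real) \<times> (nat \<times> nat \<Rightarrow> real ^ 'd)) measure)"
  define H where "H = (\<lambda>\<omega>. (\<lambda>j\<in>{..k}. (m j \<omega>, \<sigma> j \<omega>), \<lambda>(j, i)\<in>{1..k} \<times> {1..lam}. U j i \<omega>))"
  define F where "F = vimage_algebra (space M) H B"
  have "H \<in> space M \<rightarrow> space B"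
    by (auto simp: H_def B_def space_pair_measure space_PiM)
  then have H: "H \<in> F \<rightarrow>\<^sub>M B" unfolding F_def by (rule measurable_vimage_algebra1)
  have comp: "(\<lambda>x. \<lambda>j\<in>{..k}. normalized xs (fst x j)) \<in> B \<rightarrow>\<^sub>M ?S"
    unfolding B_def
    by (intro measurable_restrict measurable_compose[OF _ measurable_normalized]
        measurable_compose[OF measurable_fst] measurable_component_singleton)
  have "?past = (\<lambda>\<omega>. (\<lambda>x. \<lambda>j\<in>{..k}. normalized xs (fst x j)) (H \<omega>))"
    by (auto simp: H_def restrict_def fun_eq_iff)
  then have "?past \<in> F \<rightarrow>\<^sub>M ?S" using measurable_compose[OF H comp] by simp
  then have sub: "sets (vimage_algebra (space M) ?past ?S) \<subseteq> sets F"
    by (intro sets_image_in_sets) (auto simp: F_def)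
  have sets_Q: "sets ?Q = sets (PiM {1..lam} (\<lambda>_. borel))"
    by (intro sets_PiM_cong refl sets_std_normal_vec)
  have "indep_set (sets F) (sets (vimage_algebra (space M) ?V (PiM {1..lam} (\<lambda>_. borel))))"
    using U_indep_past[of k] unfolding F_def H_def B_def .
  then have "indep_set (sets (vimage_algebra (space M) ?past ?S)) (sets (vimage_algebra (space M) ?V ?Q))"
    unfolding indep_set_def sets_vimage_algebra sets_Q
    using sub[unfolded sets_vimage_algebra]
    by (elim indep_sets_mono_sets) (auto split: bool.splits)
  then show ?thesis
    unfolding indep_var_eq
    using directions_measurable[OF assms] measurable_restrict[OF normalized_measurable]
    by (auto simp: sets_vimage_algebra)
qed

end

theorem theorem3p9:
  fixes f :: "real ^ 'd \<Rightarrow> real"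
    and xs :: "real ^ 'd"
    and lam mu :: nat
    and w :: "nat \<Rightarrow> real"
    and ds :: real
    and M :: "'w measure"
    and m :: "nat \<Rightarrow> 'w \<Rightarrow> real ^ 'd"
    and \<sigma> :: "nat \<Rightarrow> 'w \<Rightarrow> real"
    and U :: "nat \<Rightarrow> nat \<Rightarrow> 'w \<Rightarrow> real ^ 'd"
  assumes f_continuous: "continuous_on UNIV f"
    and f_scaling: "scaling_invariant f xs"
    and f_levels: "negligible_level_sets f"
    and lam: "lam \<ge> 2"
    and mu: "mu \<in> {1..lam}"
    and w_decreasing: "antimono_on {1..mu} w"
    and w_positive: "w mu > 0"
    and w_sum: "(\<Sum>i=1..mu. w i) = 1"
    and ds: "ds > 0"
    and es: "adaptive_es M f lam mu w ds m \<sigma> U"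
  shows "let z = \<lambda>k \<omega>. normalized xs (m k \<omega>, \<sigma> k \<omega>);
             P = normalized_kernel f lam mu w ds xs
         in homogeneous_markov_chain M z P \<and> phi_irreducible P \<and> aperiodic_chain P
            \<and> T_chain P \<and> (\<forall>C. compact C \<longrightarrow> small_set P C)"
proof -
  interpret adaptive_es M f lam mu w ds m \<sigma> U by (rule es)
  have lam1: "lam \<ge> 1" and mu_lam: "mu \<le> lam" using lam mu by auto
  \<comment> \<open>The last weight is the smallest, so its positivity passes to all others.\<close>
  have w_pos: "w i > 0" if "i \<in> {1..mu}" for i
  proof -
    have "w mu \<le> w i" using monotone_onD[OF w_decreasing that] that mu by auto
    then show ?thesis using w_positive by linarith
  qed
  interpret es_kernel f xs lam mu w ds "damping TYPE('d) mu w ds"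
    by (rule es_kernel.intro[OF f_continuous f_levels mu w_pos w_sum ds refl prob_space_std_normal_vec[OF lam1]])
  obtain \<nu> where "minorized_kernel P \<nu> 2" using minorized by blast
  then interpret minorized_kernel P \<nu> 2 .
  have "homogeneous_markov_chain M (\<lambda>k \<omega>. normalized xs (m k \<omega>, \<sigma> k \<omega>)) P"
    by (rule homogeneous_markov_chain_iteration[OF prob_space_axioms markov_kernel_P normalized_measurable
          directions_measurable[OF lam1] distr_directions[OF lam1] step_measurable P_eq
          normalized_update[OF f_scaling mu_lam] indep_normalized_past[OF lam1]])
  then show ?thesis
    using phi_irreducible aperiodic_chain T_chain small_set by (simp add: Let_def)
qed

end
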